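(* For any set $T\cup\{\varphi\approx\psi\}$ of $\mathrm{Fm}^1_\forall(\mathcal{L}_s)$-equations, $$T\models^\forall_{\mathsf{FL_e}}\varphi\approx\psi\iff T^\ast\models_{\mathsf{mFL_e}}\varphi^\ast\approx\psi^\ast.$$
   Context: $\mathcal{L}_s$ is the signature with binary $\land,\lor,\cdot,\to$ and constants ${\rm f},{\rm e}$. An $\mathsf{FL_e}$-algebra is an algebra $\langle A,\land,\lor,\cdot,\to,{\rm f},{\rm e}\rangle$ such that $\langle A,\land,\lor\rangle$ is a lattice (order $a\le b$ iff $a\land b=a$), $\langle A,\cdot,{\rm e}\rangle$ is a commutative monoid, and $a\cdot b\le c\iff a\le b\to c$ for all $a,b,c$; ${\rm f}$ is an arbitrary constant. $\mathsf{FL_e}$ is the variety of these. $\mathsf{mFL_e}$ is the class of algebras $\langle\mathbf{A},\Box,\Diamond\rangle$ with $\mathbf{A}\in\mathsf{FL_e}$ satisfying $\Box x\land x\approx \Box x$, $\Box(x\land y)\approx\Box x\land\Box y$, $\Box\Diamond x\approx\Diamond x$, $\Diamond x\lor x\approx\Diamond x$, $\Diamond(x\lor y)\approx\Diamond x\lor\Diamond y$, $\Diamond\Box x\approx\Box x$, and $\Box(\star(\Box x_1,\dots,\Box x_n))\approx\star(\Box x_1,\dots,\Box x_n)$ for every $n$-ary $\star\in\mathcal{L}_s$. $\mathrm{Fm}^1_\forall(\mathcal{L}_s)$: one-variable formulas built from unary predicates $P_i$ ($i\in\mathbb{N}$) applied to a single variable $x$, connectives of $\mathcal{L}_s$, and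 $\forall x,\exists x$; an equation is a pair $\varphi\approx\psi$. For an $\mathsf{FL_e}$-algebra $\mathbf{A}$, non-empty set $S$ and maps $\mathcal{I}(P_i)\colon S\to A$, $\mathcal{S}=\langle S,\mathcal{I}\rangle$ is an $\mathbf{A}$-structure if the partial map $[\![\cdot]\!]^{\mathcal{S}}\colon\mathrm{Fm}^1_\forall(\mathcal{L}_s)\to A^S$ with $[\![P_i(x)]\!]^{\mathcal{S}}=\mathcal{I}(P_i)$, connectives interpreted pointwise, $[\![\forall x\varphi]\!]^{\mathcal{S}}(u)=\bigwedge_{v\in S}[\![\varphi]\!]^{\mathcal{S}}(v)$, $[\![\exists x\varphi]\!]^{\mathcal{S}}(u)=\bigvee_{v\in S}[\![\varphi]\!]^{\mathcal{S}}(v)$ is total. $T\models^\forall_{\mathsf{FL_e}}\varphi\approx\psi$ means: for every $\mathbf{A}\in\mathsf{FL_e}$ and $\mathbf{A}$-structure $\mathcal{S}$ with $[\![\varphi']\!]^{\mathcal{S}}=[\![\psi']\!]^{\mathcal{S}}$ for all $\varphi'\approx\psi'\in T$, also $[\![\varphi]\!]^{\mathcal{S}}=[\![\psi]\!]^{\mathcal{S}}$. $\mathrm{Fm}_\Box(\mathcal{L}_s)$: propositional formulas from variables $p_i$, connectives of $\mathcal{L}_s$ and unary $\Box,\Diamond$; the translation $(\cdot)^\ast$ sends $P_i(x)\mapsto p_i$, commutes with the connectives of $\mathcal{L}_s$, and sends $\forall x\varphi\mapsto\Box\varphi^\ast$, $\exists x\varphi\mapsto\Diamond\varphi^\ast$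 (extended to equations and sets). $\Sigma\models_{\mathsf{mFL_e}}\alpha\approx\beta$ means every homomorphism $f$ from the formula algebra on $\mathrm{Fm}_\Box(\mathcal{L}_s)$ into a member of $\mathsf{mFL_e}$ with $f(\alpha')=f(\beta')$ for all $\alpha'\approx\beta'\in\Sigma$ satisfies $f(\alpha)=f(\beta)$. *)

theory Defs
  imports "HOL-Algebra.Group"
begin

record 'a FLe_alg = "'a monoid" +
  fmeet :: "['a, 'a] \<Rightarrow> 'a" (infixl "\<curlywedge>\<index>" 70)
  fjoin :: "['a, 'a] \<Rightarrow> 'a" (infixl "\<curlyvee>\<index>" 65)
  fimp  :: "['a, 'a] \<Rightarrow> 'a" (infixr "\<leadsto>\<index>" 60)
  fzero :: 'a ("\<f>\<index>")

record 'a mFLe_alg = "'a FLe_alg" +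
  fbox :: "'a \<Rightarrow> 'a" ("\<box>\<index> _" [81] 80)
  fdia :: "'a \<Rightarrow> 'a" ("\<diamond>\<index> _" [81] 80)

definition fle :: "('a, 'm) FLe_alg_scheme \<Rightarrow> 'a \<Rightarrow> 'a \<Rightarrow> bool" (infix "\<preceq>\<index>" 50)
  where "a \<preceq>\<^bsub>A\<^esub> b \<longleftrightarrow> a \<curlywedge>\<^bsub>A\<^esub> b = a"

locale FLe_algebra = comm_monoid A for A :: "('a, 'm) FLe_alg_scheme" (structure) +
  assumes meet_closed: "\<lbrakk>a \<in> carrier A; b \<in> carrier A\<rbrakk> \<Longrightarrow> a \<curlywedge> b \<in> carrier A"
    and join_closed: "\<lbrakk>a \<in> carrier A; b \<in> carrier A\<rbrakk> \<Longrightarrow> a \<curlyvee> b \<in> carrier A"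
    and imp_closed: "\<lbrakk>a \<in> carrier A; b \<in> carrier A\<rbrakk> \<Longrightarrow> a \<leadsto> b \<in> carrier A"
    and zero_closed: "\<f> \<in> carrier A"
    and meet_comm: "\<lbrakk>a \<in> carrier A; b \<in> carrier A\<rbrakk> \<Longrightarrow> a \<curlywedge> b = b \<curlywedge> a"
    and join_comm: "\<lbrakk>a \<in> carrier A; b \<in> carrier A\<rbrakk> \<Longrightarrow> a \<curlyvee> b = b \<curlyvee> a"
    and meet_assoc: "\<lbrakk>a \<in> carrier A; b \<in> carrier A; c \<in> carrier A\<rbrakk>
          \<Longrightarrow> (a \<curlywedge> b) \<curlywedge> c = a \<curlywedge> (b \<curlywedge> c)"
    and join_assoc: "\<lbrakk>a \<in> carrier A; b \<in> carrier A; c \<in> carrier A\<rbrakk>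
          \<Longrightarrow> (a \<curlyvee> b) \<curlyvee> c = a \<curlyvee> (b \<curlyvee> c)"
    and meet_absorb: "\<lbrakk>a \<in> carrier A; b \<in> carrier A\<rbrakk> \<Longrightarrow> a \<curlywedge> (a \<curlyvee> b) = a"
    and join_absorb: "\<lbrakk>a \<in> carrier A; b \<in> carrier A\<rbrakk> \<Longrightarrow> a \<curlyvee> (a \<curlywedge> b) = a"
    and residuation: "\<lbrakk>a \<in> carrier A; b \<in> carrier A; c \<in> carrier A\<rbrakk>
          \<Longrightarrow> a \<otimes> b \<preceq> c \<longleftrightarrow> a \<preceq> b \<leadsto> c"

locale mFLe_algebra = FLe_algebra A for A :: "('a, 'm) mFLe_alg_scheme" (structure) +
  assumes box_closed: "x \<in> carrier A \<Longrightarrow> \<box> x \<in> carrier A"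
    and dia_closed: "x \<in> carrier A \<Longrightarrow> \<diamond> x \<in> carrier A"
    and box_deflationary: "x \<in> carrier A \<Longrightarrow> \<box> x \<curlywedge> x = \<box> x"
    and box_meet: "\<lbrakk>x \<in> carrier A; y \<in> carrier A\<rbrakk> \<Longrightarrow> \<box> (x \<curlywedge> y) = \<box> x \<curlywedge> \<box> y"
    and box_dia: "x \<in> carrier A \<Longrightarrow> \<box> (\<diamond> x) = \<diamond> x"
    and dia_inflationary: "x \<in> carrier A \<Longrightarrow> \<diamond> x \<curlyvee> x = \<diamond> x"
    and dia_join: "\<lbrakk>x \<in> carrier A; y \<in> carrier A\<rbrakk> \<Longrightarrow> \<diamond> (x \<curlyvee> y) = \<diamond> x \<curlyvee> \<diamond> y"
    and dia_box: "x \<in> carrier A \<Longrightarrow> \<diamond> (\<box> x) = \<box> x"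
    and box_closed_meet: "\<lbrakk>x \<in> carrier A; y \<in> carrier A\<rbrakk>
          \<Longrightarrow> \<box> (\<box> x \<curlywedge> \<box> y) = \<box> x \<curlywedge> \<box> y"
    and box_closed_join: "\<lbrakk>x \<in> carrier A; y \<in> carrier A\<rbrakk>
          \<Longrightarrow> \<box> (\<box> x \<curlyvee> \<box> y) = \<box> x \<curlyvee> \<box> y"
    and box_closed_mult: "\<lbrakk>x \<in> carrier A; y \<in> carrier A\<rbrakk>
          \<Longrightarrow> \<box> (\<box> x \<otimes> \<box> y) = \<box> x \<otimes> \<box> y"
    and box_closed_imp: "\<lbrakk>x \<in> carrier A; y \<in> carrier A\<rbrakk>
          \<Longrightarrow> \<box> (\<box> x \<leadsto> \<box> y) = \<box> x \<leadsto> \<box> y"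
    and box_closed_zero: "\<box> \<f> = \<f>"
    and box_closed_one: "\<box> \<one> = \<one>"

text \<open>\<open>Pred i\<close> stands for $P_i(x)$ and \<open>Forall\<close>, \<open>Exists\<close> for the quantifiers over the only variable $x$.\<close>

datatype fo_fm =
    Pred nat
  | Meet fo_fm fo_fm
  | Join fo_fm fo_fm
  | Mult fo_fm fo_fm
  | Imp fo_fm fo_fm
  | Zero
  | One
  | Forall fo_fm
  | Exists fo_fm

datatype modal_fm =
    MVar nat
  | MMeet modal_fm modal_fm
  | MJoin modal_fm modal_fm
  | MMult modal_fm modal_fm
  | MImp modal_fm modal_fm
  | MZero
  | MOne
  | Box modal_fm
  | Dia modal_fm

type_synonym fo_eq = "fo_fm \<times> fo_fm"
type_synonym modal_eq = "modal_fm \<times> modal_fm"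

primrec trans_fm :: "fo_fm \<Rightarrow> modal_fm" where
  "trans_fm (Pred i) = MVar i"
| "trans_fm (Meet \<phi> \<psi>) = MMeet (trans_fm \<phi>) (trans_fm \<psi>)"
| "trans_fm (Join \<phi> \<psi>) = MJoin (trans_fm \<phi>) (trans_fm \<psi>)"
| "trans_fm (Mult \<phi> \<psi>) = MMult (trans_fm \<phi>) (trans_fm \<psi>)"
| "trans_fm (Imp \<phi> \<psi>) = MImp (trans_fm \<phi>) (trans_fm \<psi>)"
| "trans_fm Zero = MZero"
| "trans_fm One = MOne"
| "trans_fm (Forall \<phi>) = Box (trans_fm \<phi>)"
| "trans_fm (Exists \<phi>) = Dia (trans_fm \<phi>)"

definition trans_eq :: "fo_eq \<Rightarrow> modal_eq" where
  "trans_eq = map_prod trans_fm trans_fm"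

definition is_glb :: "('a, 'm) FLe_alg_scheme \<Rightarrow> 'a set \<Rightarrow> 'a \<Rightarrow> bool" where
  "is_glb A X m \<longleftrightarrow> m \<in> carrier A \<and> (\<forall>x\<in>X. m \<preceq>\<^bsub>A\<^esub> x) \<and>
     (\<forall>l\<in>carrier A. (\<forall>x\<in>X. l \<preceq>\<^bsub>A\<^esub> x) \<longrightarrow> l \<preceq>\<^bsub>A\<^esub> m)"

definition is_lub :: "('a, 'm) FLe_alg_scheme \<Rightarrow> 'a set \<Rightarrow> 'a \<Rightarrow> bool" where
  "is_lub A X m \<longleftrightarrow> m \<in> carrier A \<and> (\<forall>x\<in>X. x \<preceq>\<^bsub>A\<^esub> m) \<and>
     (\<forall>u\<in>carrier A. (\<forall>x\<in>X. x \<preceq>\<^bsub>A\<^esub> u) \<longrightarrow> m \<preceq>\<^bsub>A\<^esub> u)"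

definition glb :: "('a, 'm) FLe_alg_scheme \<Rightarrow> 'a set \<Rightarrow> 'a option" where
  "glb A X = (if \<exists>m. is_glb A X m then Some (THE m. is_glb A X m) else None)"

definition lub :: "('a, 'm) FLe_alg_scheme \<Rightarrow> 'a set \<Rightarrow> 'a option" where
  "lub A X = (if \<exists>m. is_lub A X m then Some (THE m. is_lub A X m) else None)"

definition lift2 :: "'s set \<Rightarrow> ('a \<Rightarrow> 'a \<Rightarrow> 'a) \<Rightarrow> ('s \<Rightarrow> 'a) option \<Rightarrow> ('s \<Rightarrow> 'a) option \<Rightarrow> ('s \<Rightarrow> 'a) option"
  where "lift2 S h F G =
    Option.bind F (\<lambda>f. Option.bind G (\<lambda>g. Some (\<lambda>u\<in>S. h (f u) (g u))))"

text \<open>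
  The partial map $[\![\cdot]\!]^{\mathcal S}$; \<open>None\<close> means undefined. Elements of $A^S$ are
  functions extensional on \<open>S\<close>, so equality of values is equality in $A^S$.
\<close>

primrec sem :: "('a, 'm) FLe_alg_scheme \<Rightarrow> 's set \<Rightarrow> (nat \<Rightarrow> 's \<Rightarrow> 'a) \<Rightarrow> fo_fm \<Rightarrow> ('s \<Rightarrow> 'a) option" where
  "sem A S I (Pred i) = Some (I i)"
| "sem A S I (Meet \<phi> \<psi>) = lift2 S (fmeet A) (sem A S I \<phi>) (sem A S I \<psi>)"
| "sem A S I (Join \<phi> \<psi>) = lift2 S (fjoin A) (sem A S I \<phi>) (sem A S I \<psi>)"
| "sem A S I (Mult \<phi> \<psi>) = lift2 S (mult A) (sem A S I \<phi>) (sem A S I \<psi>)"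
| "sem A S I (Imp \<phi> \<psi>) = lift2 S (fimp A) (sem A S I \<phi>) (sem A S I \<psi>)"
| "sem A S I Zero = Some (\<lambda>u\<in>S. \<f>\<^bsub>A\<^esub>)"
| "sem A S I One = Some (\<lambda>u\<in>S. \<one>\<^bsub>A\<^esub>)"
| "sem A S I (Forall \<phi>) =
     Option.bind (sem A S I \<phi>) (\<lambda>f. map_option (\<lambda>m. \<lambda>u\<in>S. m) (glb A (f ` S)))"
| "sem A S I (Exists \<phi>) =
     Option.bind (sem A S I \<phi>) (\<lambda>f. map_option (\<lambda>m. \<lambda>u\<in>S. m) (lub A (f ` S)))"

definition is_structure :: "('a, 'm) FLe_alg_scheme \<Rightarrow> 's set \<Rightarrow> (nat \<Rightarrow> 's \<Rightarrow> 'a) \<Rightarrow> bool" where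
  "is_structure A S I \<longleftrightarrow> S \<noteq> {} \<and> (\<forall>i. I i \<in> S \<rightarrow>\<^sub>E carrier A) \<and> (\<forall>\<phi>. sem A S I \<phi> \<noteq> None)"

text \<open>
  HOL cannot quantify over types inside a formula, so each consequence relation is
  parameterised by the type(s) from which the carriers (arbitrary subsets) are drawn.
  The formula languages are countable, so by a downward Loewenheim-Skolem argument neither
  relation depends on the choice of these types, as long as they are infinite.
\<close>

definition FLe_consequence :: "'a itself \<Rightarrow> 's itself \<Rightarrow> fo_eq set \<Rightarrow> fo_eq \<Rightarrow> bool" where
  "FLe_consequence _ _ T e \<longleftrightarrow>
     (\<forall>(A :: 'a FLe_alg) (S :: 's set) I.
        FLe_algebra A \<longrightarrow> is_structure A S I \<longrightarrow>
        (\<forall>(\<phi>', \<psi>') \<in> T. sem A S I \<phi>' = sem A S I \<psi>') \<longrightarrow>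
        sem A S I (fst e) = sem A S I (snd e))"

definition is_modal_hom :: "('b, 'm) mFLe_alg_scheme \<Rightarrow> (modal_fm \<Rightarrow> 'b) \<Rightarrow> bool" where
  "is_modal_hom B f \<longleftrightarrow>
     (\<forall>\<alpha>. f \<alpha> \<in> carrier B) \<and>
     (\<forall>\<alpha> \<beta>. f (MMeet \<alpha> \<beta>) = f \<alpha> \<curlywedge>\<^bsub>B\<^esub> f \<beta>) \<and>
     (\<forall>\<alpha> \<beta>. f (MJoin \<alpha> \<beta>) = f \<alpha> \<curlyvee>\<^bsub>B\<^esub> f \<beta>) \<and>
     (\<forall>\<alpha> \<beta>. f (MMult \<alpha> \<beta>) = f \<alpha> \<otimes>\<^bsub>B\<^esub> f \<beta>) \<and>
     (\<forall>\<alpha> \<beta>. f (MImp \<alpha> \<beta>) = f \<alpha> \<leadsto>\<^bsub>B\<^esub> f \<beta>) \<and>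
     f MZero = \<f>\<^bsub>B\<^esub> \<and>
     f MOne = \<one>\<^bsub>B\<^esub> \<and>
     (\<forall>\<alpha>. f (Box \<alpha>) = \<box>\<^bsub>B\<^esub> (f \<alpha>)) \<and>
     (\<forall>\<alpha>. f (Dia \<alpha>) = \<diamond>\<^bsub>B\<^esub> (f \<alpha>))"

definition mFLe_consequence :: "'b itself \<Rightarrow> modal_eq set \<Rightarrow> modal_eq \<Rightarrow> bool" where
  "mFLe_consequence _ \<Sigma> e \<longleftrightarrow>
     (\<forall>(B :: 'b mFLe_alg) f.
        mFLe_algebra B \<longrightarrow> is_modal_hom B f \<longrightarrow>
        (\<forall>(\<alpha>', \<beta>') \<in> \<Sigma>. f \<alpha>' = f \<beta>') \<longrightarrow>
        f (fst e) = f (snd e))"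

end

theory Submission
  imports Defs "HOL-Algebra.FiniteProduct" "HOL-Library.Countable" "HOL-Library.Nat_Bijection"
begin

text \<open>
  From right to left, the values of formulas in a structure form an algebra in which the
  universal and existential quantifier act as box and diamond.

  From left to right, let \<open>B\<close> be an algebra with operators \<open>\<box>\<close>, \<open>\<diamond>\<close> and let \<open>B\<^sub>0\<close> be its
  subalgebra of fixed elements. It suffices to embed countably many copies of \<open>B\<close>, glued along
  \<open>B\<^sub>0\<close>, into one algebra so that \<open>\<box> b\<close> and \<open>\<diamond> b\<close> become the meet and the join of all the copies
  of \<open>b\<close>; the copies then serve as the domain. Such an amalgam is obtained directly as an algebra
  of Galois-closed sets. In any amalgam that interpolates over \<open>B\<^sub>0\<close>, a product of elements
  \<open>x\<^sub>k\<close> of the copies \<open>k\<close> lies below the element \<open>b\<close> of copy \<open>j\<close> iff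
  \<open>x\<^sub>j \<otimes> (\<Otimes>k \<noteq> j. \<diamond> x\<^sub>k) \<preceq> b\<close> in \<open>B\<close>, since \<open>\<diamond> x\<^sub>k\<close> is the best interpolant of \<open>x\<^sub>k\<close>. Taking this
  condition as the definition of the order between finitely supported words \<open>x\<close> and elements \<open>b\<close>
  yields the closed sets. Meets and joins over all copies are computed in a copy outside the
  support. Countable subalgebras suffice, so the types of the carriers only have to be infinite.
\<close>

section \<open>Order and operators\<close>

context FLe_algebra
begin

lemmas op_closed [simp, intro] = meet_closed join_closed imp_closed zero_closed

lemma meet_idem: "a \<in> carrier A \<Longrightarrow> a \<curlywedge> a = a"
  by (metis join_absorb join_closed meet_absorb meet_closed)

lemma le_refl [simp, intro]: "a \<in> carrier A \<Longrightarrow> a \<preceq> a"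
  by (simp add: fle_def meet_idem)

lemma le_antisym: "\<lbrakk>a \<preceq> b; b \<preceq> a; a \<in> carrier A; b \<in> carrier A\<rbrakk> \<Longrightarrow> a = b"
  by (metis fle_def meet_comm)

lemma le_trans [trans]:
  "\<lbrakk>a \<preceq> b; b \<preceq> c; a \<in> carrier A; b \<in> carrier A; c \<in> carrier A\<rbrakk> \<Longrightarrow> a \<preceq> c"
  by (metis fle_def meet_assoc)

lemma le_iff_join: "\<lbrakk>a \<in> carrier A; b \<in> carrier A\<rbrakk> \<Longrightarrow> a \<preceq> b \<longleftrightarrow> a \<curlyvee> b = b"
  unfolding fle_def by (metis join_absorb join_comm meet_absorb meet_comm)

lemma meet_lower: "\<lbrakk>a \<in> carrier A; b \<in> carrier A\<rbrakk> \<Longrightarrow> a \<curlywedge> b \<preceq> a \<and> a \<curlywedge> b \<preceq> b"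
  unfolding fle_def by (metis meet_assoc meet_comm meet_idem)

lemma join_upper: "\<lbrakk>a \<in> carrier A; b \<in> carrier A\<rbrakk> \<Longrightarrow> a \<preceq> a \<curlyvee> b \<and> b \<preceq> a \<curlyvee> b"
  unfolding fle_def by (metis meet_absorb join_comm)

lemma le_meet_iff:
  assumes "a \<in> carrier A" "b \<in> carrier A" "c \<in> carrier A"
  shows "a \<preceq> b \<curlywedge> c \<longleftrightarrow> a \<preceq> b \<and> a \<preceq> c"
proof
  assume "a \<preceq> b \<curlywedge> c"
  with assms show "a \<preceq> b \<and> a \<preceq> c"
    using meet_lower[of b c] by (blast intro: le_trans)
next
  assume "a \<preceq> b \<and> a \<preceq> c"
  with assms show "a \<preceq> b \<curlywedge> c"
    by (simp add: fle_def flip: meet_assoc)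
qed

lemma join_le_iff:
  assumes "a \<in> carrier A" "b \<in> carrier A" "c \<in> carrier A"
  shows "a \<curlyvee> b \<preceq> c \<longleftrightarrow> a \<preceq> c \<and> b \<preceq> c"
proof
  assume "a \<curlyvee> b \<preceq> c"
  with assms show "a \<preceq> c \<and> b \<preceq> c"
    using join_upper[of a b] by (blast intro: le_trans)
next
  assume "a \<preceq> c \<and> b \<preceq> c"
  with assms show "a \<curlyvee> b \<preceq> c"
    by (simp add: le_iff_join join_assoc)
qed

lemma mult_mono_left:
  assumes "a \<preceq> b" "a \<in> carrier A" "b \<in> carrier A" "c \<in> carrier A"
  shows "a \<otimes> c \<preceq> b \<otimes> c"
proof -
  have "b \<preceq> c \<leadsto> b \<otimes> c"
    using assms by (simp flip: residuation)
  with assms have "a \<preceq> c \<leadsto> b \<otimes> c"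
    by (blast intro: le_trans)
  with assms show ?thesis
    by (simp add: residuation)
qed

lemma mult_mono:
  assumes "a \<preceq> b" "c \<preceq> d" "a \<in> carrier A" "b \<in> carrier A" "c \<in> carrier A" "d \<in> carrier A"
  shows "a \<otimes> c \<preceq> b \<otimes> d"
proof -
  have "a \<otimes> c \<preceq> b \<otimes> c" "b \<otimes> c \<preceq> b \<otimes> d"
    using assms mult_mono_left[of a b c] mult_mono_left[of c d b] by (simp_all add: m_comm)
  with assms show ?thesis
    by (blast intro: le_trans)
qed

lemma mult_join_distrib:
  assumes "a \<in> carrier A" "b \<in> carrier A" "c \<in> carrier A"
  shows "c \<otimes> (a \<curlyvee> b) = c \<otimes> a \<curlyvee> c \<otimes> b"
proof (rule le_antisym)
  have "a \<preceq> c \<leadsto> (c \<otimes> a \<curlyvee> c \<otimes> b)" "b \<preceq> c \<leadsto> (c \<otimes> a \<curlyvee> c \<otimes> b)"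
    using assms join_upper[of "c \<otimes> a" "c \<otimes> b"] by (simp_all add: m_comm[of _ c] flip: residuation)
  then have "a \<curlyvee> b \<preceq> c \<leadsto> (c \<otimes> a \<curlyvee> c \<otimes> b)"
    using assms by (simp add: join_le_iff)
  then show "c \<otimes> (a \<curlyvee> b) \<preceq> c \<otimes> a \<curlyvee> c \<otimes> b"
    using assms by (simp add: m_comm[of c "a \<curlyvee> b"] residuation)
  show "c \<otimes> a \<curlyvee> c \<otimes> b \<preceq> c \<otimes> (a \<curlyvee> b)"
    using assms join_upper[of a b] by (simp add: join_le_iff mult_mono)
qed (use assms in auto)

lemma finprod_mono:
  assumes "finite K" "\<And>k. k \<in> K \<Longrightarrow> g k \<in> carrier A" "\<And>k. k \<in> K \<Longrightarrow> h k \<in> carrier A"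
    and "\<And>k. k \<in> K \<Longrightarrow> g k \<preceq> h k"
  shows "finprod A g K \<preceq> finprod A h K"
  using assms
proof (induction K rule: finite_induct)
  case (insert k K)
  then have "g \<in> K \<rightarrow> carrier A" "h \<in> K \<rightarrow> carrier A"
    by auto
  with insert show ?case
    by (simp add: finprod_insert mult_mono)
qed simp

lemma is_glb_unique: "\<lbrakk>is_glb A X m; is_glb A X n\<rbrakk> \<Longrightarrow> m = n"
  unfolding is_glb_def by (blast intro: le_antisym)

lemma is_lub_unique: "\<lbrakk>is_lub A X m; is_lub A X n\<rbrakk> \<Longrightarrow> m = n"
  unfolding is_lub_def by (blast intro: le_antisym)

lemma glb_eq_Some_iff: "glb A X = Some m \<longleftrightarrow> is_glb A X m"
  unfolding glb_def by (smt (verit) is_glb_unique option.distinct(1) option.inject the_equality)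

lemma lub_eq_Some_iff: "lub A X = Some m \<longleftrightarrow> is_lub A X m"
  unfolding lub_def by (smt (verit) is_lub_unique option.distinct(1) option.inject the_equality)

end

section \<open>Fixed elements and the adjoint modal operators\<close>

context mFLe_algebra
begin

lemmas modal_op_closed [simp, intro] = box_closed dia_closed

lemma box_le: "x \<in> carrier A \<Longrightarrow> \<box> x \<preceq> x"
  by (simp add: fle_def box_deflationary)

lemma le_dia: "x \<in> carrier A \<Longrightarrow> x \<preceq> \<diamond> x"
  by (metis dia_closed dia_inflationary join_comm le_iff_join)

lemma box_mono: "\<lbrakk>x \<preceq> y; x \<in> carrier A; y \<in> carrier A\<rbrakk> \<Longrightarrow> \<box> x \<preceq> \<box> y"
  by (metis box_meet fle_def)

lemma dia_mono: "\<lbrakk>x \<preceq> y; x \<in> carrier A; y \<in> carrier A\<rbrakk> \<Longrightarrow> \<diamond> x \<preceq> \<diamond> y"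
  by (metis dia_join le_iff_join dia_closed)

text \<open>The subalgebra \<open>B\<^sub>0\<close> of the outline, which is the common range of
  \<open>\<box>\<close> and \<open>\<diamond>\<close>.\<close>

definition fixed :: "'a set"
  where "fixed = {c \<in> carrier A. \<box> c = c}"

lemma fixed_carrier [simp]: "c \<in> fixed \<Longrightarrow> c \<in> carrier A"
  unfolding fixed_def by blast

lemma fixed_box [simp]: "c \<in> fixed \<Longrightarrow> \<box> c = c"
  unfolding fixed_def by blast

lemma fixed_dia [simp]: "c \<in> fixed \<Longrightarrow> \<diamond> c = c"
  by (metis dia_box fixed_box fixed_carrier)

lemma dia_fixed [simp, intro]: "x \<in> carrier A \<Longrightarrow> \<diamond> x \<in> fixed"
  unfolding fixed_def by (simp add: box_dia)

text \<open>\<open>\<box> x\<close> equals \<open>\<diamond> (\<box> x)\<close>, and diamonds are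
  fixed.\<close>

lemma box_fixed [simp, intro]: "x \<in> carrier A \<Longrightarrow> \<box> x \<in> fixed"
  by (metis box_closed dia_box dia_fixed)

lemma one_fixed [simp, intro]: "\<one> \<in> fixed"
  unfolding fixed_def by (simp add: box_closed_one)

lemma zero_fixed [simp, intro]: "\<f> \<in> fixed"
  unfolding fixed_def by (simp add: box_closed_zero)

lemma mult_fixed [simp, intro]: "\<lbrakk>c \<in> fixed; d \<in> fixed\<rbrakk> \<Longrightarrow> c \<otimes> d \<in> fixed"
  by (metis box_closed_mult box_fixed fixed_box fixed_carrier m_closed)

lemma imp_fixed [simp, intro]: "\<lbrakk>c \<in> fixed; d \<in> fixed\<rbrakk> \<Longrightarrow> c \<leadsto> d \<in> fixed"
  by (metis box_closed_imp box_fixed fixed_box fixed_carrier imp_closed)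

lemma finprod_fixed:
  assumes "finite K" "\<And>k. k \<in> K \<Longrightarrow> g k \<in> fixed"
  shows "finprod A g K \<in> fixed"
  using assms
proof (induction K rule: finite_induct)
  case (insert k K)
  then have "g \<in> K \<rightarrow> carrier A"
    by auto
  with insert show ?case
    by (simp add: finprod_insert)
qed simp

text \<open>Monotonicity and \<open>\<box> c = c\<close> make \<open>\<box>\<close> right adjoint to
  the inclusion of the fixed elements; \<open>dia_le_iff\<close> dually makes
  \<open>\<diamond>\<close> its left adjoint.\<close>

lemma le_box_iff: "\<lbrakk>c \<in> fixed; x \<in> carrier A\<rbrakk> \<Longrightarrow> c \<preceq> \<box> x \<longleftrightarrow> c \<preceq> x"
  by (metis box_closed box_le box_mono fixed_box fixed_carrier le_trans)

lemma dia_le_iff: "\<lbrakk>c \<in> fixed; x \<in> carrier A\<rbrakk> \<Longrightarrow> \<diamond> x \<preceq> c \<longleftrightarrow> x \<preceq> c"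
  by (metis dia_closed dia_mono fixed_carrier fixed_dia le_dia le_trans)

lemma dia_mult_le: "\<lbrakk>x \<in> carrier A; y \<in> carrier A\<rbrakk> \<Longrightarrow> \<diamond> (x \<otimes> y) \<preceq> \<diamond> x \<otimes> \<diamond> y"
  by (simp add: dia_le_iff le_dia mult_mono)

text \<open>The residual \<open>c \<leadsto> \<diamond> (x \<otimes> c)\<close> is fixed, so as a
  bound of \<open>x\<close> it also bounds \<open>\<diamond> x\<close>. With
  \<open>dia_mult_le\<close> this amounts to Frobenius reciprocity.\<close>

lemma dia_mult_fixed_le:
  "\<lbrakk>x \<in> carrier A; c \<in> fixed\<rbrakk> \<Longrightarrow> \<diamond> x \<otimes> c \<preceq> \<diamond> (x \<otimes> c)"
proof -
  assume x: "x \<in> carrier A" and c: "c \<in> fixed"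
  then have "x \<preceq> c \<leadsto> \<diamond> (x \<otimes> c)"
    by (simp add: le_dia flip: residuation)
  with x c have "\<diamond> x \<preceq> c \<leadsto> \<diamond> (x \<otimes> c)"
    by (simp add: dia_le_iff)
  with x c show ?thesis
    by (simp add: residuation)
qed

end

section \<open>Algebras of Galois-closed sets\<close>

text \<open>A frame for Galois closure in which each element of the second sort is represented by
  the set of words below it. Stability of these sets under division makes \<open>cl\<close> a
  nucleus.\<close>

locale closure_frame = comm_monoid M for M :: "('w, 'm) monoid_scheme" (structure) +
  fixes basic :: "'w set set"
  assumes basic_res: "\<lbrakk>Z \<in> basic; x \<in> carrier M\<rbrakk> \<Longrightarrow> {y \<in> carrier M. x \<otimes> y \<in> Z} \<in> basic"
begin

definition cl :: "'w set \<Rightarrow> 'w set"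
  where "cl X = {y \<in> carrier M. \<forall>Z\<in>basic. X \<subseteq> Z \<longrightarrow> y \<in> Z}"

definition gclosed :: "'w set \<Rightarrow> bool"
  where "gclosed X \<longleftrightarrow> cl X = X"

definition set_prod :: "'w set \<Rightarrow> 'w set \<Rightarrow> 'w set"
  where "set_prod X Y = (\<Union>x\<in>X. \<Union>y\<in>Y. {x \<otimes> y})"

definition res :: "'w set \<Rightarrow> 'w set \<Rightarrow> 'w set"
  where "res X Y = {z \<in> carrier M. \<forall>x\<in>X. x \<otimes> z \<in> Y}"

text \<open>The set \<open>F\<close> is a parameter because the laws leave the constant free; the
  amalgam will use a copy of \<open>\<f>\<close> from the modal algebra.\<close>

definition closed_alg :: "'w set \<Rightarrow> 'w set FLe_alg"
  where "closed_alg F =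
    \<lparr>carrier = {X. gclosed X}, mult = (\<lambda>X Y. cl (set_prod X Y)), one = cl {\<one>},
     fmeet = (\<inter>), fjoin = (\<lambda>X Y. cl (X \<union> Y)), fimp = res, fzero = F\<rparr>"

lemma cl_carrier: "cl X \<subseteq> carrier M"
  by (auto simp: cl_def)

lemma gclosed_carrier: "gclosed X \<Longrightarrow> X \<subseteq> carrier M"
  using cl_carrier by (auto simp: gclosed_def)

lemma subset_cl: "X \<subseteq> carrier M \<Longrightarrow> X \<subseteq> cl X"
  by (auto simp: cl_def)

lemma gclosed_cl: "gclosed (cl X)"
  by (auto simp: gclosed_def cl_def)

lemma cl_subset_iff: "\<lbrakk>gclosed Y; X \<subseteq> carrier M\<rbrakk> \<Longrightarrow> cl X \<subseteq> Y \<longleftrightarrow> X \<subseteq> Y"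
  by (auto simp: gclosed_def cl_def)

lemma gclosed_basic: "Z \<in> basic \<Longrightarrow> gclosed (carrier M \<inter> Z)"
  by (auto simp: gclosed_def cl_def)

lemma gclosed_Int: "\<lbrakk>gclosed X; gclosed Y\<rbrakk> \<Longrightarrow> gclosed (X \<inter> Y)"
proof -
  assume X: "gclosed X" and Y: "gclosed Y"
  have "X \<inter> Y \<subseteq> carrier M"
    using gclosed_carrier[OF X] by blast
  then show ?thesis
    using cl_subset_iff[OF X, of "X \<inter> Y"] cl_subset_iff[OF Y, of "X \<inter> Y"] subset_cl[of "X \<inter> Y"]
    unfolding gclosed_def by blast
qed

text \<open>For \<open>x \<in> X\<close>, division by \<open>x\<close> turns a basic set containing
  \<open>Y\<close> into a basic set containing \<open>res X Y\<close>, hence also containing its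
  closure.\<close>

lemma gclosed_res:
  assumes "gclosed Y" "X \<subseteq> carrier M"
  shows "gclosed (res X Y)"
proof -
  have "x \<otimes> z \<in> cl Y" if z: "z \<in> cl (res X Y)" and x: "x \<in> X" for x z
    unfolding cl_def
  proof (intro CollectI conjI ballI impI)
    show "x \<otimes> z \<in> carrier M"
      using z x assms(2) cl_carrier by blast
    fix Z assume Z: "Z \<in> basic" "Y \<subseteq> Z"
    have "{y \<in> carrier M. x \<otimes> y \<in> Z} \<in> basic"
      using basic_res Z x assms(2) by blast
    moreover have "res X Y \<subseteq> {y \<in> carrier M. x \<otimes> y \<in> Z}"
      using Z x by (auto simp: res_def)
    ultimately show "x \<otimes> z \<in> Z"
      using z unfolding cl_def by blast
  qed
  then have "cl (res X Y) \<subseteq> res X Y"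
    using assms cl_carrier unfolding gclosed_def by (fastforce simp: res_def)
  moreover have "res X Y \<subseteq> cl (res X Y)"
    by (rule subset_cl) (auto simp: res_def)
  ultimately show ?thesis
    by (simp add: gclosed_def)
qed

lemma set_prod_carrier: "\<lbrakk>X \<subseteq> carrier M; Y \<subseteq> carrier M\<rbrakk> \<Longrightarrow> set_prod X Y \<subseteq> carrier M"
  by (auto simp: set_prod_def)

lemma set_prod_comm: "\<lbrakk>X \<subseteq> carrier M; Y \<subseteq> carrier M\<rbrakk> \<Longrightarrow> set_prod X Y = set_prod Y X"
  unfolding set_prod_def using m_comm by (fastforce simp: subset_iff)

lemma set_prod_assoc:
  assumes "X \<subseteq> carrier M" "Y \<subseteq> carrier M" "Z \<subseteq> carrier M"
  shows "set_prod (set_prod X Y) Z = set_prod X (set_prod Y Z)"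
proof -
  have a: "(x \<otimes> y) \<otimes> z = x \<otimes> (y \<otimes> z)" if "x \<in> X" "y \<in> Y" "z \<in> Z" for x y z
    using that assms by (blast intro: m_assoc)
  show ?thesis
    by (auto simp: set_prod_def a)
qed

lemma set_prod_subset_iff:
  "\<lbrakk>X \<subseteq> carrier M; Y \<subseteq> carrier M\<rbrakk> \<Longrightarrow> set_prod X Y \<subseteq> Z \<longleftrightarrow> X \<subseteq> res Y Z"
  unfolding set_prod_def res_def using m_comm by (fastforce simp: subset_iff)

lemma cl_set_prod_subset_iff:
  "\<lbrakk>X \<subseteq> carrier M; Y \<subseteq> carrier M; gclosed Z\<rbrakk> \<Longrightarrow> cl (set_prod X Y) \<subseteq> Z \<longleftrightarrow> X \<subseteq> res Y Z"
proof -
  assume X: "X \<subseteq> carrier M" and Y: "Y \<subseteq> carrier M" and Z: "gclosed Z"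
  show ?thesis
    unfolding cl_subset_iff[OF Z set_prod_carrier[OF X Y]] by (rule set_prod_subset_iff[OF X Y])
qed

text \<open>Both sides lie below the same closed sets \<open>Z\<close>: the condition becomes
  inclusion in \<open>res Y Z\<close>, which is closed and so does not distinguish \<open>X\<close>
  from \<open>cl X\<close>.\<close>

lemma cl_set_prod_cl:
  assumes "X \<subseteq> carrier M" "Y \<subseteq> carrier M"
  shows "cl (set_prod (cl X) Y) = cl (set_prod X Y)"
proof -
  have "cl (set_prod (cl X) Y) \<subseteq> Z \<longleftrightarrow> cl (set_prod X Y) \<subseteq> Z" if "gclosed Z" for Z
    using that assms
    by (simp add: cl_set_prod_subset_iff cl_carrier cl_subset_iff gclosed_res)
  then show ?thesis
    by (meson gclosed_cl subset_antisym subset_refl)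
qed

lemma cl_cl_Un:
  assumes "X \<subseteq> carrier M" "Y \<subseteq> carrier M"
  shows "cl (cl X \<union> Y) = cl (X \<union> Y)"
proof -
  have "cl (cl X \<union> Y) \<subseteq> Z \<longleftrightarrow> cl (X \<union> Y) \<subseteq> Z" if "gclosed Z" for Z
    using that assms by (simp add: cl_subset_iff cl_carrier)
  then show ?thesis
    by (meson gclosed_cl subset_antisym subset_refl)
qed

lemma FLe_algebra_closed_alg:
  assumes "gclosed F"
  shows "FLe_algebra (closed_alg F)"
proof -
  have c: "X \<subseteq> carrier M" if "gclosed X" for X
    using that by (rule gclosed_carrier)
  have one: "cl (set_prod (cl {\<one>}) X) = X" if "gclosed X" for X
  proof -
    have "set_prod {\<one>} X = X"
      using c[OF that] unfolding set_prod_def by (force simp: subset_iff)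
    then show ?thesis
      using that c[OF that] by (simp add: cl_set_prod_cl gclosed_def)
  qed
  have comm: "cl (set_prod X Y) = cl (set_prod Y X)" if "gclosed X" "gclosed Y" for X Y
    using that c by (simp add: set_prod_comm)
  have assoc: "cl (set_prod (cl (set_prod X Y)) Z) = cl (set_prod X (cl (set_prod Y Z)))"
    if "gclosed X" "gclosed Y" "gclosed Z" for X Y Z
  proof -
    have "cl (set_prod (cl (set_prod X Y)) Z) = cl (set_prod X (set_prod Y Z))"
      using that c by (simp add: cl_set_prod_cl set_prod_carrier set_prod_assoc)
    also have "\<dots> = cl (set_prod (cl (set_prod Y Z)) X)"
      using that c by (simp add: cl_set_prod_cl set_prod_carrier set_prod_comm[of X])
    also have "\<dots> = cl (set_prod X (cl (set_prod Y Z)))"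
      using that by (simp add: comm gclosed_cl)
    finally show ?thesis .
  qed
  show ?thesis
    unfolding closed_alg_def
  proof (unfold_locales, simp_all add: gclosed_cl gclosed_Int gclosed_res c assms fle_def one assoc)
    fix X Y assume "gclosed X" "gclosed Y"
    then show "cl (set_prod X Y) = cl (set_prod Y X)"
      by (rule comm)
  next
    fix X assume "gclosed X"
    then show "cl (set_prod X (cl {\<one>})) = X"
      using one comm gclosed_cl by metis
  next
    fix X Y assume "gclosed X" "gclosed Y"
    show "X \<inter> Y = Y \<inter> X" by blast
  next
    fix X Y assume "gclosed X" "gclosed Y"
    show "cl (X \<union> Y) = cl (Y \<union> X)" by (simp add: Un_commute)
  next
    fix X Y Z assume "gclosed X" "gclosed Y" "gclosed Z"
    show "X \<inter> Y \<inter> Z = X \<inter> (Y \<inter> Z)" by blast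
  next
    fix X Y Z assume "gclosed X" "gclosed Y" "gclosed Z"
    then show "cl (cl (X \<union> Y) \<union> Z) = cl (X \<union> cl (Y \<union> Z))"
      using c cl_cl_Un[of "X \<union> Y" Z] cl_cl_Un[of "Y \<union> Z" X] by (simp add: Un_ac)
  next
    fix X Y assume "gclosed X" "gclosed Y"
    then show "X \<inter> cl (X \<union> Y) = X"
      using subset_cl[of "X \<union> Y"] c by blast
  next
    \<comment> \<open>What remains of \<open>join_absorb\<close> once
      \<open>X \<union> (X \<inter> Y)\<close> is simplified to \<open>X\<close>.\<close>
    fix X Y assume "gclosed X" "gclosed Y"
    then show "cl X = X"
      by (simp add: gclosed_def)
  next
    fix X Y Z assume "gclosed X" "gclosed Y" "gclosed Z"
    then show "(cl (set_prod X Y) \<inter> Z = cl (set_prod X Y)) = (X \<inter> res Y Z = X)"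
      using c cl_set_prod_subset_iff[of X Y Z] by (simp add: inf.absorb_iff1)
  qed
qed

end

section \<open>The amalgam of countably many copies\<close>

context mFLe_algebra
begin

text \<open>A word stands for the formal product of the elements \<open>x k\<close> of the copies
  \<open>k\<close>. Finite support keeps these products finite and leaves copies in which the word
  is trivial.\<close>

definition words :: "(nat \<Rightarrow> 'a) set"
  where "words = {x. (\<forall>k. x k \<in> carrier A) \<and> finite {k. x k \<noteq> \<one>}}"

definition word_monoid :: "(nat \<Rightarrow> 'a) monoid"
  where "word_monoid = \<lparr>carrier = words, mult = (\<lambda>x y k. x k \<otimes> y k), one = (\<lambda>k. \<one>)\<rparr>"

definition single :: "nat \<Rightarrow> 'a \<Rightarrow> nat \<Rightarrow> 'a"
  where "single i a = (\<lambda>k. if k = i then a else \<one>)"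

text \<open>How copy \<open>j\<close> reads a letter of copy \<open>k\<close>: a letter of another
  copy is known only through its least upper bound in \<open>fixed\<close>.\<close>

definition view :: "nat \<Rightarrow> nat \<Rightarrow> 'a \<Rightarrow> 'a"
  where "view j k a = (if k = j then a else \<diamond> a)"

text \<open>The evaluating copy \<open>j\<close> and the omitted index \<open>i\<close> are
  independent, so that any letter can be split off from a value.\<close>

definition rest :: "nat \<Rightarrow> nat \<Rightarrow> (nat \<Rightarrow> 'a) \<Rightarrow> 'a"
  where "rest j i x = finprod A (\<lambda>k. view j k (x k)) ({k. x k \<noteq> \<one>} - {i})"

definition val :: "nat \<Rightarrow> (nat \<Rightarrow> 'a) \<Rightarrow> 'a"
  where "val j x = x j \<otimes> rest j j x"

text \<open>The context \<open>x\<close> provides stability under division; the sets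
  \<open>emb i a\<close> arise from the trivial context.\<close>

definition basic_words :: "(nat \<Rightarrow> 'a) set set"
  where "basic_words = {{y \<in> words. val j (x \<otimes>\<^bsub>word_monoid\<^esub> y) \<preceq> b} |x j b. x \<in> words \<and> b \<in> carrier A}"

definition emb :: "nat \<Rightarrow> 'a \<Rightarrow> (nat \<Rightarrow> 'a) set"
  where "emb i a = {y \<in> words. val i y \<preceq> a}"

section \<open>Words and their values\<close>

lemma word_simps [simp]:
  "carrier word_monoid = words" "(x \<otimes>\<^bsub>word_monoid\<^esub> y) k = x k \<otimes> y k" "\<one>\<^bsub>word_monoid\<^esub> k = \<one>"
  by (simp_all add: word_monoid_def)

lemma wordsI: "\<lbrakk>\<And>k. x k \<in> carrier A; finite {k. x k \<noteq> \<one>}\<rbrakk> \<Longrightarrow> x \<in> words"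
  unfolding words_def by blast

lemma words_carrier [simp]: "x \<in> words \<Longrightarrow> x k \<in> carrier A"
  unfolding words_def by blast

lemma words_finite [simp]: "x \<in> words \<Longrightarrow> finite {k. x k \<noteq> \<one>}"
  unfolding words_def by blast

lemma words_mult [simp]:
  assumes "x \<in> words" "y \<in> words"
  shows "x \<otimes>\<^bsub>word_monoid\<^esub> y \<in> words"
proof -
  have "{k. x k \<otimes> y k \<noteq> \<one>} \<subseteq> {k. x k \<noteq> \<one>} \<union> {k. y k \<noteq> \<one>}"
    by auto
  then have "finite {k. x k \<otimes> y k \<noteq> \<one>}"
    by (rule finite_subset) (use assms in simp)
  with assms show ?thesis
    by (intro wordsI) simp_all
qed

lemma single_words [simp]: "a \<in> carrier A \<Longrightarrow> single i a \<in> words"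
  by (rule wordsI) (simp_all add: single_def)

lemma one_words [simp]: "\<one>\<^bsub>word_monoid\<^esub> \<in> words"
  by (rule wordsI) simp_all

lemma comm_monoid_words: "comm_monoid word_monoid"
  by unfold_locales (auto simp: fun_eq_iff m_ac)

lemma view_closed [simp]: "a \<in> carrier A \<Longrightarrow> view j k a \<in> carrier A"
  by (simp add: view_def)

lemma view_one [simp]: "view j k \<one> = \<one>"
  by (simp add: view_def)

lemma view_mono: "\<lbrakk>a \<preceq> b; a \<in> carrier A; b \<in> carrier A\<rbrakk> \<Longrightarrow> view j k a \<preceq> view j k b"
  by (simp add: view_def dia_mono)

lemma view_le_dia: "a \<in> carrier A \<Longrightarrow> view j k a \<preceq> \<diamond> a"
  by (simp add: view_def le_dia)

lemma view_mult_fixed_le: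
  "\<lbrakk>a \<in> carrier A; c \<in> fixed\<rbrakk> \<Longrightarrow> view j k a \<otimes> c \<preceq> view j k (a \<otimes> c)"
  by (simp add: view_def dia_mult_fixed_le)

lemma view_mult_le:
  "\<lbrakk>a \<in> carrier A; b \<in> carrier A\<rbrakk> \<Longrightarrow> view j k (a \<otimes> b) \<preceq> view j k a \<otimes> \<diamond> b"
  by (simp add: view_def dia_mult_le mult_mono le_dia)

lemma view_mult_join:
  "\<lbrakk>a \<in> carrier A; b \<in> carrier A; c \<in> carrier A\<rbrakk>
    \<Longrightarrow> view j k (c \<otimes> (a \<curlyvee> b)) = view j k (c \<otimes> a) \<curlyvee> view j k (c \<otimes> b)"
  by (simp add: view_def mult_join_distrib dia_join)

lemma rest_eq:
  assumes "x \<in> words" "finite K" "{k. x k \<noteq> \<one>} \<subseteq> K"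
  shows "rest j i x = finprod A (\<lambda>k. view j k (x k)) (K - {i})"
  unfolding rest_def
  by (rule finprod_mono_neutral_cong_left) (use assms in auto)

lemma rest_closed [simp]: "x \<in> words \<Longrightarrow> rest j i x \<in> carrier A"
  unfolding rest_def by (rule finprod_closed) auto

lemma val_closed [simp]: "x \<in> words \<Longrightarrow> val j x \<in> carrier A"
  by (simp add: val_def)

text \<open>With \<open>j = i\<close> the only letter not seen through \<open>\<diamond>\<close> is
  the omitted one.\<close>

lemma rest_fixed [simp]: "x \<in> words \<Longrightarrow> rest i i x \<in> fixed"
  unfolding rest_def by (rule finprod_fixed) (auto simp: view_def)

text \<open>Splitting off letter \<open>i\<close> or letter \<open>j\<close> gives the same product
  of views, over a finite \<open>K\<close> containing both indices.\<close>

lemma val_eq: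
  assumes x: "x \<in> words"
  shows "val j x = view j i (x i) \<otimes> rest j i x"
proof -
  define K where "K = {k. x k \<noteq> \<one>} \<union> {i, j}"
  have K: "finite K" "{k. x k \<noteq> \<one>} \<subseteq> K" "i \<in> K" "j \<in> K"
    using x by (auto simp: K_def)
  have "view j l (x l) \<otimes> rest j l x = finprod A (\<lambda>k. view j k (x k)) K" if "l \<in> K" for l
  proof -
    have "finprod A (\<lambda>k. view j k (x k)) (insert l (K - {l})) = view j l (x l) \<otimes> rest j l x"
      unfolding rest_eq[OF x K(1,2)] by (rule finprod_insert) (use x K in auto)
    with that show ?thesis
      by (simp add: insert_absorb)
  qed
  from this[OF K(3)] this[OF K(4)] show ?thesis
    by (simp add: val_def view_def)
qed

text \<open>Away from \<open>i\<close>, copy \<open>i\<close> sees the letters of \<open>y\<close>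
  as diamonds, so \<open>view_mult_le\<close> bounds each factor. The gain is that
  \<open>rest i i y\<close> is fixed.\<close>

lemma rest_mult_le:
  assumes x: "x \<in> words" and y: "y \<in> words"
  shows "rest j i (x \<otimes>\<^bsub>word_monoid\<^esub> y) \<preceq> rest j i x \<otimes> rest i i y"
proof -
  define K where "K = {k. x k \<noteq> \<one>} \<union> {k. y k \<noteq> \<one>}"
  have K: "finite K" "{k. x k \<noteq> \<one>} \<subseteq> K" "{k. y k \<noteq> \<one>} \<subseteq> K"
      "{k. (x \<otimes>\<^bsub>word_monoid\<^esub> y) k \<noteq> \<one>} \<subseteq> K"
    using x y by (auto simp: K_def)
  have "rest j i (x \<otimes>\<^bsub>word_monoid\<^esub> y) = finprod A (\<lambda>k. view j k (x k \<otimes> y k)) (K - {i})"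
    unfolding rest_eq[OF words_mult[OF x y] K(1,4)] by simp
  also have "\<dots> \<preceq> finprod A (\<lambda>k. view j k (x k) \<otimes> view i k (y k)) (K - {i})"
    by (rule finprod_mono) (use x y K view_mult_le in \<open>auto simp: view_def[of i]\<close>)
  also have "\<dots> = rest j i x \<otimes> rest i i y"
    unfolding rest_eq[OF x K(1,2)] rest_eq[OF y K(1,3)]
    by (rule finprod_multf) (use x y in auto)
  finally show ?thesis .
qed

lemma rest_mult_single [simp]:
  assumes x: "x \<in> words" and a: "a \<in> carrier A"
  shows "rest j i (x \<otimes>\<^bsub>word_monoid\<^esub> single i a) = rest j i x"
proof -
  define K where "K = {k. x k \<noteq> \<one>} \<union> {i}"
  have K: "finite K" "{k. x k \<noteq> \<one>} \<subseteq> K" "{k. (x \<otimes>\<^bsub>word_monoid\<^esub> single i a) k \<noteq> \<one>} \<subseteq> K"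
    using x by (auto simp: K_def single_def)
  show ?thesis
    unfolding rest_eq[OF x K(1,2)] rest_eq[OF words_mult[OF x single_words[OF a]] K(1,3)]
    by (rule finprod_cong') (use x in \<open>auto simp: single_def\<close>)
qed

lemma val_mult_single:
  "\<lbrakk>x \<in> words; a \<in> carrier A\<rbrakk>
    \<Longrightarrow> val j (x \<otimes>\<^bsub>word_monoid\<^esub> single i a) = view j i (x i \<otimes> a) \<otimes> rest j i x"
  by (simp add: val_eq[where i = i]) (simp add: single_def)

lemma rest_single: "a \<in> carrier A \<Longrightarrow> rest j i (single i a) = \<one>"
  unfolding rest_def single_def by (rule finprod_one_eqI) auto

lemma val_single: "a \<in> carrier A \<Longrightarrow> val i (single i a) = a"
  by (simp add: val_def rest_single) (simp add: single_def)

text \<open>The cut rule, where \<open>val i y \<preceq> a\<close> is read as a sequent.\<close>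

lemma val_cut:
  assumes x: "x \<in> words" and y: "y \<in> words" and a: "a \<in> carrier A" and le: "val i y \<preceq> a"
  shows "val j (x \<otimes>\<^bsub>word_monoid\<^esub> y) \<preceq> val j (x \<otimes>\<^bsub>word_monoid\<^esub> single i a)"
proof -
  have xi: "x i \<in> carrier A" and yi: "y i \<in> carrier A" and rj: "rest j i x \<in> carrier A"
    and ri: "rest i i y \<in> carrier A" and rf: "rest i i y \<in> fixed"
    and vc: "view j i (x i \<otimes> y i) \<in> carrier A"
    using x y by auto
  have "val j (x \<otimes>\<^bsub>word_monoid\<^esub> y) = view j i (x i \<otimes> y i) \<otimes> rest j i (x \<otimes>\<^bsub>word_monoid\<^esub> y)"
    using x y by (simp add: val_eq[where i = i])
  also have "\<dots> \<preceq> view j i (x i \<otimes> y i) \<otimes> (rest j i x \<otimes> rest i i y)"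
    using x y rest_mult_le by (simp add: mult_mono)
  also have "\<dots> = (view j i (x i \<otimes> y i) \<otimes> rest i i y) \<otimes> rest j i x"
    using vc rj ri by (simp add: m_ac)
  \<comment> \<open>The fixed factor \<open>rest i i y\<close> may enter the view of letter
    \<open>i\<close> by Frobenius reciprocity; inside, it completes \<open>y i\<close> to
    \<open>val i y\<close>, which is bounded by \<open>a\<close>.\<close>
  also have "\<dots> \<preceq> view j i ((x i \<otimes> y i) \<otimes> rest i i y) \<otimes> rest j i x"
    using xi yi rj ri rf view_mult_fixed_le by (simp add: mult_mono)
  also have "\<dots> \<preceq> view j i (x i \<otimes> a) \<otimes> rest j i x"
  proof -
    have "(x i \<otimes> y i) \<otimes> rest i i y \<preceq> x i \<otimes> a"
      using le a xi yi ri by (simp add: val_def m_assoc mult_mono)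
    then show ?thesis
      using a xi yi ri rj by (simp add: mult_mono view_mono)
  qed
  finally show ?thesis
    unfolding val_mult_single[OF x a] using x y a by (simp del: word_simps(2))
qed

text \<open>Division by \<open>x\<close> only extends the context from \<open>w\<close> to the
  product of \<open>w\<close> and \<open>x\<close>.\<close>

lemma basic_words_res:
  assumes "Z \<in> basic_words" "x \<in> words"
  shows "{y \<in> words. x \<otimes>\<^bsub>word_monoid\<^esub> y \<in> Z} \<in> basic_words"
proof -
  interpret comm_monoid word_monoid
    by (rule comm_monoid_words)
  from assms(1) obtain w j b where w: "w \<in> words" "b \<in> carrier A"
    and Z: "Z = {y \<in> words. val j (w \<otimes>\<^bsub>word_monoid\<^esub> y) \<preceq> b}"
    unfolding basic_words_def by blast
  have "{y \<in> words. x \<otimes>\<^bsub>word_monoid\<^esub> y \<in> Z}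
      = {y \<in> words. val j ((w \<otimes>\<^bsub>word_monoid\<^esub> x) \<otimes>\<^bsub>word_monoid\<^esub> y) \<preceq> b}"
    unfolding Z using w assms(2) m_assoc[of w x] by auto
  moreover have "w \<otimes>\<^bsub>word_monoid\<^esub> x \<in> words"
    using w assms(2) by simp
  ultimately show ?thesis
    unfolding basic_words_def using w(2) by blast
qed

section \<open>The frame of words and the embedded copies\<close>

sublocale word: closure_frame word_monoid basic_words
proof -
  interpret comm_monoid word_monoid
    by (rule comm_monoid_words)
  show "closure_frame word_monoid basic_words"
    by unfold_locales (use basic_words_res in simp)
qed

lemma emb_basic:
  assumes "a \<in> carrier A"
  shows "emb i a \<in> basic_words"
proof -
  have "emb i a = {y \<in> words. val i (\<one>\<^bsub>word_monoid\<^esub> \<otimes>\<^bsub>word_monoid\<^esub> y) \<preceq> a}"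
    unfolding emb_def using word.l_one by auto
  with assms show ?thesis
    unfolding basic_words_def using one_words by blast
qed

lemma emb_words: "emb i a \<subseteq> words"
  by (auto simp: emb_def)

lemma emb_gclosed: "a \<in> carrier A \<Longrightarrow> word.gclosed (emb i a)"
  using word.gclosed_basic[OF emb_basic] emb_words by (simp add: Int_absorb1)

text \<open>By \<open>val_cut\<close>, a word \<open>y\<close> with
  \<open>val i y \<preceq> a\<close> may replace \<open>single i a\<close> in every context, so a
  basic set containing the latter contains \<open>y\<close>. Later computations thereby reduce to
  one generating word.\<close>

lemma emb_eq_cl:
  assumes a: "a \<in> carrier A"
  shows "emb i a = word.cl {single i a}"
proof
  show "word.cl {single i a} \<subseteq> emb i a"
    using a by (simp add: word.cl_subset_iff emb_gclosed) (simp add: emb_def val_single)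
  show "emb i a \<subseteq> word.cl {single i a}"
  proof
    fix y assume "y \<in> emb i a"
    then have y: "y \<in> words" "val i y \<preceq> a"
      by (auto simp: emb_def)
    have "y \<in> Z" if Z: "Z \<in> basic_words" "single i a \<in> Z" for Z
    proof -
      obtain w j b where w: "w \<in> words" "b \<in> carrier A"
        and Z_eq: "Z = {y \<in> words. val j (w \<otimes>\<^bsub>word_monoid\<^esub> y) \<preceq> b}"
        using Z(1) unfolding basic_words_def by blast
      have "val j (w \<otimes>\<^bsub>word_monoid\<^esub> y) \<preceq> b"
      proof (rule le_trans)
        show "val j (w \<otimes>\<^bsub>word_monoid\<^esub> y) \<preceq> val j (w \<otimes>\<^bsub>word_monoid\<^esub> single i a)"
          by (rule val_cut) (use w y a in auto)
        show "val j (w \<otimes>\<^bsub>word_monoid\<^esub> single i a) \<preceq> b"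
          using Z(2) Z_eq by blast
      qed (use w y a in \<open>simp_all del: word_simps(2)\<close>)
      with y Z_eq show ?thesis by blast
    qed
    with y show "y \<in> word.cl {single i a}"
      by (simp add: word.cl_def)
  qed
qed

lemma emb_subset_iff:
  assumes "a \<in> carrier A" "b \<in> carrier A"
  shows "emb i a \<subseteq> emb i b \<longleftrightarrow> a \<preceq> b"
proof -
  have "emb i a \<subseteq> emb i b \<longleftrightarrow> single i a \<in> emb i b"
    unfolding emb_eq_cl[OF assms(1)] using assms by (simp add: word.cl_subset_iff emb_gclosed)
  with assms show ?thesis
    by (simp add: emb_def val_single)
qed

lemma emb_inj: "\<lbrakk>emb i a = emb i b; a \<in> carrier A; b \<in> carrier A\<rbrakk> \<Longrightarrow> a = b"
  by (metis emb_subset_iff le_antisym subset_refl)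

text \<open>If \<open>val i y \<preceq> c\<close>, residuation puts \<open>y i\<close>, hence also
  \<open>\<diamond> (y i)\<close>, below a fixed element. So the product of the diamonds of all
  letters lies below \<open>c\<close>, and it bounds \<open>val j y\<close> for every
  \<open>j\<close>. This glues the copies along \<open>fixed\<close>.\<close>

lemma emb_fixed:
  assumes c: "c \<in> fixed"
  shows "emb i c = emb j c"
proof -
  have "val j y \<preceq> c" if y: "y \<in> words" and le: "val i y \<preceq> c" for i j y
  proof -
    have "y i \<preceq> rest i i y \<leadsto> c"
      using le y c by (simp add: val_def residuation)
    then have "\<diamond> (y i) \<preceq> rest i i y \<leadsto> c"
      using y c by (simp add: dia_le_iff)
    then have 1: "\<diamond> (y i) \<otimes> rest i i y \<preceq> c"
      using y c by (simp add: residuation)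
    have "rest j i y \<preceq> rest i i y"
      unfolding rest_def by (rule finprod_mono) (use y view_le_dia in \<open>auto simp: view_def[of i]\<close>)
    then have "val j y \<preceq> \<diamond> (y i) \<otimes> rest i i y"
      using y by (simp add: val_eq[of y j i] mult_mono view_le_dia)
    from le_trans[OF this 1] y c show ?thesis
      by simp
  qed
  then show ?thesis
    unfolding emb_def by blast
qed

lemma emb_meet: "\<lbrakk>a \<in> carrier A; b \<in> carrier A\<rbrakk> \<Longrightarrow> emb i (a \<curlywedge> b) = emb i a \<inter> emb i b"
  by (auto simp: emb_def le_meet_iff)

text \<open>Under the closure both factors can be replaced by their generators, which multiply
  within copy \<open>i\<close>.\<close>

lemma emb_mult:
  assumes a: "a \<in> carrier A" and b: "b \<in> carrier A"
  shows "emb i (a \<otimes> b) = word.cl (word.set_prod (emb i a) (emb i b))"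
proof -
  have s: "single i a \<otimes>\<^bsub>word_monoid\<^esub> single i b = single i (a \<otimes> b)"
    using a b by (auto simp: single_def fun_eq_iff)
  have "word.cl (word.set_prod (emb i a) (emb i b)) = word.cl (word.set_prod {single i a} (emb i b))"
    unfolding emb_eq_cl[OF a] using a emb_words by (simp add: word.cl_set_prod_cl)
  also have "\<dots> = word.cl (word.set_prod (emb i b) {single i a})"
    using a emb_words by (simp add: word.set_prod_comm[of "{single i a}"])
  also have "\<dots> = word.cl (word.set_prod {single i b} {single i a})"
    unfolding emb_eq_cl[OF b] using a b by (simp add: word.cl_set_prod_cl)
  also have "\<dots> = word.cl {single i (a \<otimes> b)}"
    using a b by (simp add: word.set_prod_comm[of "{single i b}"]) (simp add: word.set_prod_def s)
  finally show ?thesis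
    using a b by (simp add: emb_eq_cl)
qed

lemma emb_one: "emb i \<one> = word.cl {\<one>\<^bsub>word_monoid\<^esub>}"
proof -
  have "single i \<one> = \<one>\<^bsub>word_monoid\<^esub>"
    by (auto simp: single_def fun_eq_iff)
  then show ?thesis
    by (simp add: emb_eq_cl)
qed

text \<open>The generator suffices to test membership in the residual: it multiplies the value in
  copy \<open>i\<close> by \<open>a\<close>, and \<open>val_cut\<close> passes from it to all of
  \<open>emb i a\<close>.\<close>

lemma emb_imp:
  assumes a: "a \<in> carrier A" and b: "b \<in> carrier A"
  shows "emb i (a \<leadsto> b) = word.res (emb i a) (emb i b)"
proof -
  have v: "val i (z \<otimes>\<^bsub>word_monoid\<^esub> single i a) \<preceq> b \<longleftrightarrow> val i z \<preceq> a \<leadsto> b" if z: "z \<in> words" for z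
  proof -
    have "val i (z \<otimes>\<^bsub>word_monoid\<^esub> single i a) = val i z \<otimes> a"
      unfolding val_mult_single[OF z a] using z a by (simp add: val_def view_def m_ac)
    with a b z show ?thesis
      by (simp add: residuation)
  qed
  show ?thesis
  proof (intro subset_antisym subsetI)
    fix z assume "z \<in> emb i (a \<leadsto> b)"
    then have z: "z \<in> words" "val i (z \<otimes>\<^bsub>word_monoid\<^esub> single i a) \<preceq> b"
      using v by (auto simp: emb_def)
    have "x \<otimes>\<^bsub>word_monoid\<^esub> z \<in> emb i b" if "x \<in> emb i a" for x
    proof -
      have x: "x \<in> words" "val i x \<preceq> a"
        using that by (auto simp: emb_def)
      have "val i (z \<otimes>\<^bsub>word_monoid\<^esub> x) \<preceq> b"
        by (rule le_trans[OF val_cut[OF z(1) x(1) a x(2)] z(2)])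
          (use x z a b in \<open>simp_all del: word_simps(2)\<close>)
      then show ?thesis
        using x z word.m_comm[of x z] by (simp add: emb_def del: word_simps(2))
    qed
    with z show "z \<in> word.res (emb i a) (emb i b)"
      by (simp add: word.res_def)
  next
    fix z assume z: "z \<in> word.res (emb i a) (emb i b)"
    then have zw: "z \<in> words"
      by (simp add: word.res_def)
    have "single i a \<in> emb i a"
      using a by (simp add: emb_def val_single)
    with z have "single i a \<otimes>\<^bsub>word_monoid\<^esub> z \<in> emb i b"
      unfolding word.res_def by blast
    then have "val i (z \<otimes>\<^bsub>word_monoid\<^esub> single i a) \<preceq> b"
      using zw a word.m_comm[of z "single i a"] by (simp add: emb_def del: word_simps(2))
    with v zw show "z \<in> emb i (a \<leadsto> b)"
      by (simp add: emb_def)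
  qed
qed

text \<open>In every context the view of \<open>w i \<otimes> _\<close> preserves binary joins, so a
  basic set containing the generators of \<open>a\<close> and \<open>b\<close> contains that of
  \<open>a \<curlyvee> b\<close>.\<close>

lemma emb_join:
  assumes a: "a \<in> carrier A" and b: "b \<in> carrier A"
  shows "emb i (a \<curlyvee> b) = word.cl (emb i a \<union> emb i b)"
proof
  have sub: "emb i a \<union> emb i b \<subseteq> emb i (a \<curlyvee> b)"
    using a b join_upper[of a b] by (simp add: emb_subset_iff)
  then show "word.cl (emb i a \<union> emb i b) \<subseteq> emb i (a \<curlyvee> b)"
    using a b emb_words by (simp add: word.cl_subset_iff emb_gclosed)
  have "single i (a \<curlyvee> b) \<in> Z" if Z: "Z \<in> basic_words" "emb i a \<union> emb i b \<subseteq> Z" for Z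
  proof -
    obtain w j d where w: "w \<in> words" "d \<in> carrier A"
      and Z_eq: "Z = {y \<in> words. val j (w \<otimes>\<^bsub>word_monoid\<^esub> y) \<preceq> d}"
      using Z(1) unfolding basic_words_def by blast
    have "single i a \<in> emb i a" "single i b \<in> emb i b"
      using a b by (auto simp: emb_def val_single)
    then have "single i a \<in> Z" "single i b \<in> Z"
      using Z(2) by auto
    then have "val j (w \<otimes>\<^bsub>word_monoid\<^esub> single i a) \<preceq> d" "val j (w \<otimes>\<^bsub>word_monoid\<^esub> single i b) \<preceq> d"
      unfolding Z_eq by blast+
    then have "view j i (w i \<otimes> a) \<preceq> rest j i w \<leadsto> d" "view j i (w i \<otimes> b) \<preceq> rest j i w \<leadsto> d"
      unfolding val_mult_single[OF w(1) a] val_mult_single[OF w(1) b]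
      using w a b by (simp_all add: residuation)
    then have "view j i (w i \<otimes> (a \<curlyvee> b)) \<preceq> rest j i w \<leadsto> d"
      using w a b by (simp add: view_mult_join join_le_iff)
    then have "val j (w \<otimes>\<^bsub>word_monoid\<^esub> single i (a \<curlyvee> b)) \<preceq> d"
      unfolding val_mult_single[OF w(1) join_closed[OF a b]] using w a b by (simp add: residuation)
    then show ?thesis
      unfolding Z_eq using a b by simp
  qed
  then have "single i (a \<curlyvee> b) \<in> word.cl (emb i a \<union> emb i b)"
    using a b by (simp add: word.cl_def)
  then show "emb i (a \<curlyvee> b) \<subseteq> word.cl (emb i a \<union> emb i b)"
    using a b by (simp add: emb_eq_cl[of "a \<curlyvee> b"] word.cl_subset_iff word.gclosed_cl)
qed

section \<open>Meets and joins over all copies\<close>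

lemma fresh_index:
  assumes "x \<in> words"
  obtains i where "i \<noteq> j" "x i = \<one>"
proof -
  have "finite (insert j {k. x k \<noteq> \<one>})"
    using assms by simp
  then show ?thesis
    using that ex_new_if_finite[OF infinite_UNIV_nat] by blast
qed

text \<open>In a copy \<open>i\<close> where \<open>y\<close> has a trivial letter,
  \<open>val i y\<close> is fixed. There \<open>val i y \<preceq> b\<close> already yields
  \<open>val i y \<preceq> \<box> b\<close>, and \<open>emb_fixed\<close> transfers this to copy
  \<open>j\<close>.\<close>

lemma subset_emb_box:
  assumes b: "b \<in> carrier A" and L: "\<And>i. L \<subseteq> emb i b"
  shows "L \<subseteq> emb j (\<box> b)"
proof
  fix y assume "y \<in> L"
  then have y: "y \<in> words" "\<And>i. val i y \<preceq> b"
    using L by (auto simp: emb_def)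
  obtain i where i: "y i = \<one>"
    using fresh_index[OF y(1)] by blast
  then have v: "val i y = rest i i y"
    using y(1) by (simp add: val_def)
  have "val i y \<preceq> \<box> b"
    using y b v by (metis le_box_iff rest_fixed)
  with y(1) have "y \<in> emb i (\<box> b)"
    by (simp add: emb_def)
  with b show "y \<in> emb j (\<box> b)"
    using emb_fixed[of "\<box> b" i j] by simp
qed

text \<open>Every basic set has a context \<open>w\<close> that is trivial in some copy
  \<open>i\<close> other than the evaluating copy \<open>j\<close>. A letter placed there is seen
  only through \<open>\<diamond>\<close>, so \<open>b\<close> and \<open>\<diamond> b\<close> become
  indistinguishable.\<close>

lemma emb_dia_subset:
  assumes b: "b \<in> carrier A" and U: "word.gclosed U" "\<And>i. emb i b \<subseteq> U"
  shows "emb k (\<diamond> b) \<subseteq> U"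
proof -
  have "emb k (\<diamond> b) \<subseteq> Z" if Z: "Z \<in> basic_words" "U \<subseteq> Z" for Z
  proof -
    obtain w j d where w: "w \<in> words" "d \<in> carrier A"
      and Z_eq: "Z = {y \<in> words. val j (w \<otimes>\<^bsub>word_monoid\<^esub> y) \<preceq> d}"
      using Z(1) unfolding basic_words_def by blast
    obtain i where i: "i \<noteq> j" "w i = \<one>"
      using fresh_index[OF w(1)] by blast
    have "single i b \<in> emb i b"
      using b by (simp add: emb_def val_single)
    then have "single i b \<in> Z"
      using U Z by blast
    then have "val j (w \<otimes>\<^bsub>word_monoid\<^esub> single i b) \<preceq> d"
      unfolding Z_eq by blast
    moreover have "val j (w \<otimes>\<^bsub>word_monoid\<^esub> single i (\<diamond> b)) = val j (w \<otimes>\<^bsub>word_monoid\<^esub> single i b)"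
      unfolding val_mult_single[OF w(1) b] val_mult_single[OF w(1) dia_closed[OF b]]
      using i b by (simp add: view_def)
    ultimately have "single i (\<diamond> b) \<in> Z"
      unfolding Z_eq using b by simp
    moreover have "emb i (\<diamond> b) = emb k (\<diamond> b)"
      using b by (simp add: emb_fixed[of "\<diamond> b" i k])
    moreover have "word.gclosed Z"
    proof -
      have "Z = words \<inter> Z"
        unfolding Z_eq by blast
      with word.gclosed_basic[OF Z(1)] show ?thesis by simp
    qed
    ultimately show ?thesis
      using b emb_eq_cl[of "\<diamond> b" i] word.cl_subset_iff[of Z "{single i (\<diamond> b)}"] by simp
  qed
  then have "emb k (\<diamond> b) \<subseteq> word.cl U"
    using emb_words by (fastforce simp: word.cl_def)
  with U(1) show ?thesis
    by (simp add: word.gclosed_def)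
qed

end

section \<open>Algebras named by formulas\<close>

instance fo_fm :: countable
  by countable_datatype

text \<open>
  \<open>c\<close> names the values of formulas under some interpretation, equal values having equal names.
  This moves a countable algebra of values into an arbitrary infinite type.
\<close>

definition term_alg :: "(fo_fm \<Rightarrow> 'c) \<Rightarrow> 'z \<Rightarrow> ('c, 'z) FLe_alg_scheme"
  where "term_alg c M =
    \<lparr>carrier = range c,
     mult = (\<lambda>x y. c (Mult (inv_into UNIV c x) (inv_into UNIV c y))),
     one = c One,
     fmeet = (\<lambda>x y. c (Meet (inv_into UNIV c x) (inv_into UNIV c y))),
     fjoin = (\<lambda>x y. c (Join (inv_into UNIV c x) (inv_into UNIV c y))),
     fimp = (\<lambda>x y. c (Imp (inv_into UNIV c x) (inv_into UNIV c y))),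
     fzero = c Zero,
     \<dots> = M\<rparr>"

definition modal_term_alg :: "(fo_fm \<Rightarrow> 'c) \<Rightarrow> 'c mFLe_alg"
  where "modal_term_alg c =
    term_alg c (mFLe_alg.fields (\<lambda>x. c (Forall (inv_into UNIV c x))) (\<lambda>x. c (Exists (inv_into UNIV c x))))"

text \<open>Formulas are countable: a representative \<open>r \<phi>\<close> of each class of equal
  values is numbered, and the numbers are injected into \<open>'c\<close>.\<close>

lemma ex_fo_fm_code:
  fixes F :: "fo_fm \<Rightarrow> 'd"
  assumes "infinite (UNIV :: 'c set)"
  obtains c :: "fo_fm \<Rightarrow> 'c" where "\<And>\<phi> \<psi>. c \<phi> = c \<psi> \<longleftrightarrow> F \<phi> = F \<psi>"
proof -
  obtain h :: "nat \<Rightarrow> 'c" where h: "inj h"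
    using infinite_countable_subset[OF assms] by blast
  define r where "r \<phi> = (SOME \<chi>. F \<chi> = F \<phi>)" for \<phi>
  have F_r: "F (r \<phi>) = F \<phi>" for \<phi>
    unfolding r_def by (rule someI) simp
  have "r \<phi> = r \<psi>" if "F \<phi> = F \<psi>" for \<phi> \<psi>
    using that by (simp add: r_def)
  with F_r have "r \<phi> = r \<psi> \<longleftrightarrow> F \<phi> = F \<psi>" for \<phi> \<psi>
    by metis
  then have "h (to_nat (r \<phi>)) = h (to_nat (r \<psi>)) \<longleftrightarrow> F \<phi> = F \<psi>" for \<phi> \<psi>
    using h by (simp add: inj_eq)
  then show thesis
    by (rule that)
qed

text \<open>The names form, up to renaming, a subalgebra of the power of \<open>A\<close> over
  \<open>S\<close>. A one-point \<open>S\<close> covers evaluation in \<open>A\<close> itself, the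
  domain of a structure covers its semantics.\<close>

locale term_model = FLe_algebra A for A :: "('a, 'm) FLe_alg_scheme" (structure) +
  fixes S :: "'s set" and ev :: "'s \<Rightarrow> fo_fm \<Rightarrow> 'a" and c :: "fo_fm \<Rightarrow> 'c"
  assumes ev_closed [simp]: "s \<in> S \<Longrightarrow> ev s \<phi> \<in> carrier A"
    and ev_simps [simp]:
      "s \<in> S \<Longrightarrow> ev s (Meet \<phi> \<psi>) = ev s \<phi> \<curlywedge> ev s \<psi>"
      "s \<in> S \<Longrightarrow> ev s (Join \<phi> \<psi>) = ev s \<phi> \<curlyvee> ev s \<psi>"
      "s \<in> S \<Longrightarrow> ev s (Mult \<phi> \<psi>) = ev s \<phi> \<otimes> ev s \<psi>"
      "s \<in> S \<Longrightarrow> ev s (Imp \<phi> \<psi>) = ev s \<phi> \<leadsto> ev s \<psi>"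
      "s \<in> S \<Longrightarrow> ev s Zero = \<f>"
      "s \<in> S \<Longrightarrow> ev s One = \<one>"
    and code_eq_iff: "c \<phi> = c \<psi> \<longleftrightarrow> (\<forall>s\<in>S. ev s \<phi> = ev s \<psi>)"
begin

lemma ev_inv_code [simp]: "s \<in> S \<Longrightarrow> ev s (inv_into UNIV c (c \<phi>)) = ev s \<phi>"
  using code_eq_iff[of "inv_into UNIV c (c \<phi>)" \<phi>] by (simp add: f_inv_into_f)

lemma term_alg_simps:
  "carrier (term_alg c M) = range c"
  "c \<phi> \<otimes>\<^bsub>term_alg c M\<^esub> c \<psi> = c (Mult \<phi> \<psi>)"
  "\<one>\<^bsub>term_alg c M\<^esub> = c One"
  "c \<phi> \<curlywedge>\<^bsub>term_alg c M\<^esub> c \<psi> = c (Meet \<phi> \<psi>)"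
  "c \<phi> \<curlyvee>\<^bsub>term_alg c M\<^esub> c \<psi> = c (Join \<phi> \<psi>)"
  "c \<phi> \<leadsto>\<^bsub>term_alg c M\<^esub> c \<psi> = c (Imp \<phi> \<psi>)"
  "\<f>\<^bsub>term_alg c M\<^esub> = c Zero"
  by (simp_all add: term_alg_def code_eq_iff)

lemma term_alg_le_iff: "c \<phi> \<preceq>\<^bsub>term_alg c M\<^esub> c \<psi> \<longleftrightarrow> (\<forall>s\<in>S. ev s \<phi> \<preceq> ev s \<psi>)"
  by (simp add: fle_def term_alg_simps code_eq_iff)

lemma FLe_algebra_term_alg: "FLe_algebra (term_alg c M)"
  by unfold_locales
    (auto simp: term_alg_simps term_alg_le_iff rangeI code_eq_iff residuation m_assoc
      meet_assoc join_assoc meet_absorb join_absorb,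
      simp_all add: m_comm meet_comm join_comm)

end

section \<open>Quantifiers as modal operators\<close>

locale quantified_term_model = term_model +
  assumes ev_Forall: "s \<in> S \<Longrightarrow> is_glb A ((\<lambda>u. ev u \<phi>) ` S) (ev s (Forall \<phi>))"
    and ev_Exists: "s \<in> S \<Longrightarrow> is_lub A ((\<lambda>u. ev u \<phi>) ` S) (ev s (Exists \<phi>))"
begin

lemma Forall_le: "\<lbrakk>s \<in> S; u \<in> S\<rbrakk> \<Longrightarrow> ev s (Forall \<phi>) \<preceq> ev u \<phi>"
  using ev_Forall[of s \<phi>] by (simp add: is_glb_def)

lemma le_Forall: "\<lbrakk>s \<in> S; l \<in> carrier A; \<And>u. u \<in> S \<Longrightarrow> l \<preceq> ev u \<phi>\<rbrakk> \<Longrightarrow> l \<preceq> ev s (Forall \<phi>)"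
  using ev_Forall[of s \<phi>] by (simp add: is_glb_def)

lemma le_Exists: "\<lbrakk>s \<in> S; u \<in> S\<rbrakk> \<Longrightarrow> ev u \<phi> \<preceq> ev s (Exists \<phi>)"
  using ev_Exists[of s \<phi>] by (simp add: is_lub_def)

lemma Exists_le: "\<lbrakk>s \<in> S; l \<in> carrier A; \<And>u. u \<in> S \<Longrightarrow> ev u \<phi> \<preceq> l\<rbrakk> \<Longrightarrow> ev s (Exists \<phi>) \<preceq> l"
  using ev_Exists[of s \<phi>] by (simp add: is_lub_def)

lemma Forall_const: "\<lbrakk>s \<in> S; u \<in> S\<rbrakk> \<Longrightarrow> ev s (Forall \<phi>) = ev u (Forall \<phi>)"
  using is_glb_unique ev_Forall by blast

lemma Exists_const: "\<lbrakk>s \<in> S; u \<in> S\<rbrakk> \<Longrightarrow> ev s (Exists \<phi>) = ev u (Exists \<phi>)"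
  using is_lub_unique ev_Exists by blast

lemma Forall_of_const:
  assumes "\<And>s u. \<lbrakk>s \<in> S; u \<in> S\<rbrakk> \<Longrightarrow> ev s \<phi> = ev u \<phi>" "s \<in> S"
  shows "ev s (Forall \<phi>) = ev s \<phi>"
proof (rule le_antisym)
  have "ev s \<phi> \<preceq> ev u \<phi>" if "u \<in> S" for u
    using that assms(1)[OF assms(2) that] by simp
  with assms(2) show "ev s \<phi> \<preceq> ev s (Forall \<phi>)"
    by (intro le_Forall) auto
qed (use assms(2) in \<open>auto intro: Forall_le\<close>)

lemma Exists_of_const:
  assumes "\<And>s u. \<lbrakk>s \<in> S; u \<in> S\<rbrakk> \<Longrightarrow> ev s \<phi> = ev u \<phi>" "s \<in> S"
  shows "ev s (Exists \<phi>) = ev s \<phi>"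
proof (rule le_antisym)
  have "ev u \<phi> \<preceq> ev s \<phi>" if "u \<in> S" for u
    using that assms(1)[OF assms(2) that] by simp
  with assms(2) show "ev s (Exists \<phi>) \<preceq> ev s \<phi>"
    by (intro Exists_le) auto
qed (use assms(2) in \<open>auto intro: le_Exists\<close>)

lemma Forall_mono:
  assumes "\<And>u. u \<in> S \<Longrightarrow> ev u \<phi> \<preceq> ev u \<psi>" "s \<in> S"
  shows "ev s (Forall \<phi>) \<preceq> ev s (Forall \<psi>)"
proof (rule le_Forall)
  fix u assume "u \<in> S"
  then show "ev s (Forall \<phi>) \<preceq> ev u \<psi>"
    using le_trans[OF Forall_le[OF assms(2)] assms(1)] assms(2) by simp
qed (use assms in auto)

lemma Exists_mono:
  assumes "\<And>u. u \<in> S \<Longrightarrow> ev u \<phi> \<preceq> ev u \<psi>" "s \<in> S"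
  shows "ev s (Exists \<phi>) \<preceq> ev s (Exists \<psi>)"
proof (rule Exists_le)
  fix u assume "u \<in> S"
  then show "ev u \<phi> \<preceq> ev s (Exists \<psi>)"
    using le_trans[OF assms(1) le_Exists[OF assms(2)]] assms(2) by simp
qed (use assms in auto)

lemma Forall_Meet:
  assumes s: "s \<in> S"
  shows "ev s (Forall (Meet \<phi> \<psi>)) = ev s (Forall \<phi>) \<curlywedge> ev s (Forall \<psi>)"
proof (rule le_antisym)
  show "ev s (Forall (Meet \<phi> \<psi>)) \<preceq> ev s (Forall \<phi>) \<curlywedge> ev s (Forall \<psi>)"
    using s meet_lower by (simp add: le_meet_iff Forall_mono)
  show "ev s (Forall \<phi>) \<curlywedge> ev s (Forall \<psi>) \<preceq> ev s (Forall (Meet \<phi> \<psi>))"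
  proof (rule le_Forall)
    fix u assume u: "u \<in> S"
    have m: "ev s (Forall \<phi>) \<curlywedge> ev s (Forall \<psi>) \<preceq> ev s (Forall \<phi>)"
        "ev s (Forall \<phi>) \<curlywedge> ev s (Forall \<psi>) \<preceq> ev s (Forall \<psi>)"
      using s meet_lower by simp_all
    show "ev s (Forall \<phi>) \<curlywedge> ev s (Forall \<psi>) \<preceq> ev u (Meet \<phi> \<psi>)"
      using le_trans[OF m(1) Forall_le[of s u]] le_trans[OF m(2) Forall_le[of s u]] s u
      by (simp add: le_meet_iff)
  qed (use s in auto)
qed (use s in auto)

lemma Exists_Join:
  assumes s: "s \<in> S"
  shows "ev s (Exists (Join \<phi> \<psi>)) = ev s (Exists \<phi>) \<curlyvee> ev s (Exists \<psi>)"
proof (rule le_antisym)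
  show "ev s (Exists \<phi>) \<curlyvee> ev s (Exists \<psi>) \<preceq> ev s (Exists (Join \<phi> \<psi>))"
    using s join_upper by (simp add: join_le_iff Exists_mono)
  show "ev s (Exists (Join \<phi> \<psi>)) \<preceq> ev s (Exists \<phi>) \<curlyvee> ev s (Exists \<psi>)"
  proof (rule Exists_le)
    fix u assume u: "u \<in> S"
    have m: "ev s (Exists \<phi>) \<preceq> ev s (Exists \<phi>) \<curlyvee> ev s (Exists \<psi>)"
        "ev s (Exists \<psi>) \<preceq> ev s (Exists \<phi>) \<curlyvee> ev s (Exists \<psi>)"
      using s join_upper by simp_all
    show "ev u (Join \<phi> \<psi>) \<preceq> ev s (Exists \<phi>) \<curlyvee> ev s (Exists \<psi>)"
      using le_trans[OF le_Exists[of s u] m(1)] le_trans[OF le_Exists[of s u] m(2)] s u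
      by (simp add: join_le_iff)
  qed (use s in auto)
qed (use s in auto)

text \<open>Makes the quantifier well defined on names, whatever formula \<open>inv_into\<close>
  picks.\<close>

lemma Forall_cong:
  assumes "\<And>u. u \<in> S \<Longrightarrow> ev u \<phi> = ev u \<psi>" "s \<in> S"
  shows "ev s (Forall \<phi>) = ev s (Forall \<psi>)"
  by (rule le_antisym) (use assms in \<open>auto intro: Forall_mono\<close>)

lemma Exists_cong:
  assumes "\<And>u. u \<in> S \<Longrightarrow> ev u \<phi> = ev u \<psi>" "s \<in> S"
  shows "ev s (Exists \<phi>) = ev s (Exists \<psi>)"
  by (rule le_antisym) (use assms in \<open>auto intro: Exists_mono\<close>)

lemma modal_term_alg_simps:
  "carrier (modal_term_alg c) = range c"
  "c \<phi> \<otimes>\<^bsub>modal_term_alg c\<^esub> c \<psi> = c (Mult \<phi> \<psi>)"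
  "\<one>\<^bsub>modal_term_alg c\<^esub> = c One"
  "c \<phi> \<curlywedge>\<^bsub>modal_term_alg c\<^esub> c \<psi> = c (Meet \<phi> \<psi>)"
  "c \<phi> \<curlyvee>\<^bsub>modal_term_alg c\<^esub> c \<psi> = c (Join \<phi> \<psi>)"
  "c \<phi> \<leadsto>\<^bsub>modal_term_alg c\<^esub> c \<psi> = c (Imp \<phi> \<psi>)"
  "\<f>\<^bsub>modal_term_alg c\<^esub> = c Zero"
  "\<box>\<^bsub>modal_term_alg c\<^esub> (c \<phi>) = c (Forall \<phi>)"
  "\<diamond>\<^bsub>modal_term_alg c\<^esub> (c \<phi>) = c (Exists \<phi>)"
  unfolding modal_term_alg_def
  by (simp_all add: term_alg_simps)
    (auto simp: term_alg_def mFLe_alg.defs code_eq_iff intro: Forall_cong Exists_cong)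

lemma mFLe_algebra_modal_term_alg: "mFLe_algebra (modal_term_alg c)"
proof -
  interpret C: FLe_algebra "modal_term_alg c"
    unfolding modal_term_alg_def by (rule FLe_algebra_term_alg)
  \<comment> \<open>Each listed \<open>\<chi>\<close> has the same value at all points of
    \<open>S\<close>, so quantifying over it changes nothing. The laws by which
    \<open>\<box>\<close> fixes compound terms rest on this principle.\<close>
  have const: "ev s (Forall \<chi>) = ev s \<chi>"
    if s: "s \<in> S" and \<chi>: "\<chi> \<in> {Zero, One, Exists \<phi>, Meet (Forall \<phi>) (Forall \<psi>),
      Join (Forall \<phi>) (Forall \<psi>), Mult (Forall \<phi>) (Forall \<psi>), Imp (Forall \<phi>) (Forall \<psi>)}"
    for s \<chi> \<phi> \<psi>
  proof (rule Forall_of_const[OF _ s])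
    fix s u assume "s \<in> S" "u \<in> S"
    then show "ev s \<chi> = ev u \<chi>"
      using \<chi> Forall_const[of s u \<phi>] Forall_const[of s u \<psi>] Exists_const[of s u \<phi>] by auto
  qed
  have Forall_consts: "ev s (Forall Zero) = \<f>" "ev s (Forall One) = \<one>"
      "ev s (Forall (Exists \<phi>)) = ev s (Exists \<phi>)"
      "ev s (Forall (Join (Forall \<phi>) (Forall \<psi>))) = ev s (Forall \<phi>) \<curlyvee> ev s (Forall \<psi>)"
      "ev s (Forall (Mult (Forall \<phi>) (Forall \<psi>))) = ev s (Forall \<phi>) \<otimes> ev s (Forall \<psi>)"
      "ev s (Forall (Imp (Forall \<phi>) (Forall \<psi>))) = ev s (Forall \<phi>) \<leadsto> ev s (Forall \<psi>)"
      "ev s (Forall (Forall \<phi>)) = ev s (Forall \<phi>)"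
    if "s \<in> S" for s \<phi> \<psi>
    using that const[OF that, of _ \<phi> \<psi>] Forall_of_const[OF Forall_const that, of \<phi>] by simp_all
  have fle: "ev s (Forall \<phi>) \<curlywedge> ev s \<phi> = ev s (Forall \<phi>)" if "s \<in> S" for s \<phi>
    using Forall_le[OF that that] by (simp add: fle_def)
  have ele: "ev s (Exists \<phi>) \<curlyvee> ev s \<phi> = ev s (Exists \<phi>)" if "s \<in> S" for s \<phi>
    using le_Exists[OF that that] that by (simp add: le_iff_join join_comm)
  have dia_box: "ev s (Exists (Forall \<phi>)) = ev s (Forall \<phi>)" if "s \<in> S" for s \<phi>
    using Exists_of_const[OF Forall_const that] .
  show ?thesis
    by unfold_locales
      (auto simp: modal_term_alg_simps rangeI code_eq_iff Forall_consts fle ele dia_box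
        Forall_Meet Exists_Join)
qed

end

section \<open>Structures versus modal algebras\<close>

primrec modal_eval :: "('b, 'm) mFLe_alg_scheme \<Rightarrow> (nat \<Rightarrow> 'b) \<Rightarrow> modal_fm \<Rightarrow> 'b" where
  "modal_eval B v (MVar i) = v i"
| "modal_eval B v (MMeet \<alpha> \<beta>) = modal_eval B v \<alpha> \<curlywedge>\<^bsub>B\<^esub> modal_eval B v \<beta>"
| "modal_eval B v (MJoin \<alpha> \<beta>) = modal_eval B v \<alpha> \<curlyvee>\<^bsub>B\<^esub> modal_eval B v \<beta>"
| "modal_eval B v (MMult \<alpha> \<beta>) = modal_eval B v \<alpha> \<otimes>\<^bsub>B\<^esub> modal_eval B v \<beta>"
| "modal_eval B v (MImp \<alpha> \<beta>) = modal_eval B v \<alpha> \<leadsto>\<^bsub>B\<^esub> modal_eval B v \<beta>"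
| "modal_eval B v MZero = \<f>\<^bsub>B\<^esub>"
| "modal_eval B v MOne = \<one>\<^bsub>B\<^esub>"
| "modal_eval B v (Box \<alpha>) = \<box>\<^bsub>B\<^esub> (modal_eval B v \<alpha>)"
| "modal_eval B v (Dia \<alpha>) = \<diamond>\<^bsub>B\<^esub> (modal_eval B v \<alpha>)"

lemma (in mFLe_algebra) is_modal_hom_modal_eval:
  assumes "\<And>i. v i \<in> carrier A"
  shows "is_modal_hom A (modal_eval A v)"
proof -
  have "modal_eval A v \<alpha> \<in> carrier A" for \<alpha>
    by (induction \<alpha>) (use assms in auto)
  then show ?thesis
    by (simp add: is_modal_hom_def)
qed

lemma trans_eq_Pair: "trans_eq (\<phi>, \<psi>) = (trans_fm \<phi>, trans_fm \<psi>)"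
  by (simp add: trans_eq_def)

section \<open>From structures to modal algebras\<close>

lemma (in FLe_algebra) sem_closed:
  assumes "is_structure A S I" "sem A S I \<phi> = Some f"
  shows "f \<in> S \<rightarrow>\<^sub>E carrier A"
  using assms(2)
proof (induction \<phi> arbitrary: f)
  case (Pred n)
  then show ?case
    using assms(1) by (auto simp: is_structure_def)
next
  case (Forall \<phi>)
  then obtain g m where "glb A (g ` S) = Some m" "f = (\<lambda>u\<in>S. m)"
    by (auto simp: bind_eq_Some_conv)
  then show ?case
    by (auto simp: glb_eq_Some_iff is_glb_def)
next
  case (Exists \<phi>)
  then obtain g m where "lub A (g ` S) = Some m" "f = (\<lambda>u\<in>S. m)"
    by (auto simp: bind_eq_Some_conv)
  then show ?case
    by (auto simp: lub_eq_Some_iff is_lub_def)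
qed (fastforce simp: lift2_def bind_eq_Some_conv PiE_iff)+

lemma (in FLe_algebra) quantified_term_model_sem:
  assumes st: "is_structure A S I" and F: "\<And>\<phi>. sem A S I \<phi> = Some (F \<phi>)"
    and c: "\<And>\<phi> \<psi>. c \<phi> = c \<psi> \<longleftrightarrow> F \<phi> = F \<psi>"
  shows "quantified_term_model A S (\<lambda>s \<phi>. F \<phi> s) c"
proof unfold_locales
  have cl: "F \<phi> \<in> S \<rightarrow>\<^sub>E carrier A" for \<phi>
    using sem_closed[OF st F] .
  show "F \<phi> s \<in> carrier A" if "s \<in> S" for s \<phi>
    using cl that by (auto simp: PiE_iff)
  show "c \<phi> = c \<psi> \<longleftrightarrow> (\<forall>s\<in>S. F \<phi> s = F \<psi> s)" for \<phi> \<psi>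
    using c PiE_ext[OF cl cl] by metis
  have ops: "F (Meet \<phi> \<psi>) = (\<lambda>u\<in>S. F \<phi> u \<curlywedge> F \<psi> u)"
      "F (Join \<phi> \<psi>) = (\<lambda>u\<in>S. F \<phi> u \<curlyvee> F \<psi> u)"
      "F (Mult \<phi> \<psi>) = (\<lambda>u\<in>S. F \<phi> u \<otimes> F \<psi> u)"
      "F (Imp \<phi> \<psi>) = (\<lambda>u\<in>S. F \<phi> u \<leadsto> F \<psi> u)"
      "F Zero = (\<lambda>u\<in>S. \<f>)" "F One = (\<lambda>u\<in>S. \<one>)" for \<phi> \<psi>
    using F[of "Meet \<phi> \<psi>"] F[of "Join \<phi> \<psi>"] F[of "Mult \<phi> \<psi>"] F[of "Imp \<phi> \<psi>"] F[of Zero] F[of One]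
    by (simp_all add: F lift2_def)
  show "F (Meet \<phi> \<psi>) s = F \<phi> s \<curlywedge> F \<psi> s" if "s \<in> S" for s \<phi> \<psi>
    using that by (simp add: ops)
  show "F (Join \<phi> \<psi>) s = F \<phi> s \<curlyvee> F \<psi> s" if "s \<in> S" for s \<phi> \<psi>
    using that by (simp add: ops)
  show "F (Mult \<phi> \<psi>) s = F \<phi> s \<otimes> F \<psi> s" if "s \<in> S" for s \<phi> \<psi>
    using that by (simp add: ops)
  show "F (Imp \<phi> \<psi>) s = F \<phi> s \<leadsto> F \<psi> s" if "s \<in> S" for s \<phi> \<psi>
    using that by (simp add: ops)
  show "F Zero s = \<f>" if "s \<in> S" for s
    using that by (simp add: ops)
  show "F One s = \<one>" if "s \<in> S" for s
    using that by (simp add: ops)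
  show "is_glb A ((\<lambda>u. F \<phi> u) ` S) (F (Forall \<phi>) s)" if "s \<in> S" for s \<phi>
  proof -
    obtain m where "is_glb A (F \<phi> ` S) m" "F (Forall \<phi>) = (\<lambda>u\<in>S. m)"
      using F[of "Forall \<phi>"] by (auto simp: F glb_eq_Some_iff)
    with that show ?thesis
      by simp
  qed
  show "is_lub A ((\<lambda>u. F \<phi> u) ` S) (F (Exists \<phi>) s)" if "s \<in> S" for s \<phi>
  proof -
    obtain m where "is_lub A (F \<phi> ` S) m" "F (Exists \<phi>) = (\<lambda>u\<in>S. m)"
      using F[of "Exists \<phi>"] by (auto simp: F lub_eq_Some_iff)
    with that show ?thesis
      by simp
  qed
qed

text \<open>Sending \<open>MVar i\<close> to the name of \<open>Pred i\<close> evaluates each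
  translated formula to the name of the formula, so the same equations hold in the algebra of names
  as in the structure.\<close>

lemma FLe_consequence_if_mFLe_consequence:
  assumes inf: "infinite (UNIV :: 'b set)"
    and cons: "mFLe_consequence TYPE('b) (trans_eq ` T) (trans_eq (\<phi>, \<psi>))"
  shows "FLe_consequence TYPE('a) TYPE('s) T (\<phi>, \<psi>)"
  unfolding FLe_consequence_def
proof (intro allI impI)
  fix A :: "'a FLe_alg" and S :: "'s set" and I
  assume A: "FLe_algebra A" and st: "is_structure A S I"
    and T: "\<forall>(\<phi>', \<psi>') \<in> T. sem A S I \<phi>' = sem A S I \<psi>'"
  define F where "F \<chi> = the (sem A S I \<chi>)" for \<chi>
  have F: "sem A S I \<chi> = Some (F \<chi>)" for \<chi>
    using st by (simp add: is_structure_def F_def)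
  obtain c :: "fo_fm \<Rightarrow> 'b" where c: "\<And>\<phi> \<psi>. c \<phi> = c \<psi> \<longleftrightarrow> F \<phi> = F \<psi>"
    using ex_fo_fm_code[OF inf] by blast
  interpret quantified_term_model A S "\<lambda>s \<phi>. F \<phi> s" c
    using FLe_algebra.quantified_term_model_sem[OF A st F c] .
  let ?f = "modal_eval (modal_term_alg c) (\<lambda>i. c (Pred i))"
  have f: "?f (trans_fm \<chi>) = c \<chi>" for \<chi>
    by (induction \<chi>) (simp_all add: modal_term_alg_simps)
  have hom: "is_modal_hom (modal_term_alg c) ?f"
    using mFLe_algebra.is_modal_hom_modal_eval[OF mFLe_algebra_modal_term_alg]
    by (simp add: modal_term_alg_simps)
  have T': "\<forall>(\<alpha>', \<beta>') \<in> trans_eq ` T. ?f \<alpha>' = ?f \<beta>'"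
    using T by (fastforce simp: trans_eq_Pair f c F)
  have "?f (trans_fm \<phi>) = ?f (trans_fm \<psi>)"
    using cons[unfolded mFLe_consequence_def, rule_format,
        OF mFLe_algebra_modal_term_alg hom T'[rule_format]]
    by (simp add: trans_eq_Pair)
  then show "sem A S I (fst (\<phi>, \<psi>)) = sem A S I (snd (\<phi>, \<psi>))"
    by (simp add: f c F)
qed

section \<open>From modal algebras to structures\<close>

text \<open>
  Only quantifier-free formulas matter here: they serve as terms naming the elements of the
  subalgebra generated by the range of \<open>v\<close>. The values at quantified formulas are junk.
\<close>

primrec prop_eval :: "('a, 'm) FLe_alg_scheme \<Rightarrow> (nat \<Rightarrow> 'a) \<Rightarrow> fo_fm \<Rightarrow> 'a" where
  "prop_eval A v (Pred n) = v n"
| "prop_eval A v (Meet \<phi> \<psi>) = prop_eval A v \<phi> \<curlywedge>\<^bsub>A\<^esub> prop_eval A v \<psi>"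
| "prop_eval A v (Join \<phi> \<psi>) = prop_eval A v \<phi> \<curlyvee>\<^bsub>A\<^esub> prop_eval A v \<psi>"
| "prop_eval A v (Mult \<phi> \<psi>) = prop_eval A v \<phi> \<otimes>\<^bsub>A\<^esub> prop_eval A v \<psi>"
| "prop_eval A v (Imp \<phi> \<psi>) = prop_eval A v \<phi> \<leadsto>\<^bsub>A\<^esub> prop_eval A v \<psi>"
| "prop_eval A v Zero = \<f>\<^bsub>A\<^esub>"
| "prop_eval A v One = \<one>\<^bsub>A\<^esub>"
| "prop_eval A v (Forall \<phi>) = prop_eval A v \<phi>"
| "prop_eval A v (Exists \<phi>) = prop_eval A v \<phi>"

lemma (in FLe_algebra) prop_eval_closed:
  "(\<And>n. v n \<in> carrier A) \<Longrightarrow> prop_eval A v \<phi> \<in> carrier A"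
  by (induction \<phi>) auto

text \<open>The domain has one point per copy, and point \<open>h i\<close> gives
  \<open>\<phi>\<close> the copy \<open>i\<close> of \<open>f (trans_fm \<phi>)\<close>. The algebra
  is the countable part of the amalgam generated by these values, renamed into
  \<open>'c\<close>.\<close>

lemma (in mFLe_algebra) ex_separating_structure:
  fixes f :: "modal_fm \<Rightarrow> 'a"
  assumes infc: "infinite (UNIV :: 'c set)" and infs: "infinite (UNIV :: 's set)"
    and hom: "is_modal_hom A f"
  obtains C :: "'c FLe_alg" and S :: "'s set" and I where
    "FLe_algebra C" "is_structure C S I"
    "\<And>\<phi> \<psi>. sem C S I \<phi> = sem C S I \<psi> \<longleftrightarrow> f (trans_fm \<phi>) = f (trans_fm \<psi>)"
proof -
  let ?W = "word.closed_alg (emb 0 \<f>)"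
  \<comment> \<open>A variable number encodes a copy and a formula, so that
    \<open>G i \<phi>\<close> is an atomic term for the copy \<open>i\<close> of the value of
    \<open>\<phi>\<close>.\<close>
  define v where "v n = (case prod_decode n of (i, m) \<Rightarrow> emb i (f (trans_fm (from_nat m))))" for n
  define G where "G i \<phi> = Pred (prod_encode (i, to_nat (\<phi> :: fo_fm)))" for i \<phi>
  let ?ev = "prop_eval ?W v"
  have fc [simp]: "f \<alpha> \<in> carrier A" for \<alpha>
    using hom by (simp add: is_modal_hom_def)
  have W: "FLe_algebra ?W"
    by (rule word.FLe_algebra_closed_alg) (simp add: emb_gclosed)
  have W_simps: "carrier ?W = {X. word.gclosed X}" "\<And>X Y. X \<otimes>\<^bsub>?W\<^esub> Y = word.cl (word.set_prod X Y)"
      "\<one>\<^bsub>?W\<^esub> = word.cl {\<one>\<^bsub>word_monoid\<^esub>}" "\<And>X Y. X \<curlywedge>\<^bsub>?W\<^esub> Y = X \<inter> Y"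
      "\<And>X Y. X \<curlyvee>\<^bsub>?W\<^esub> Y = word.cl (X \<union> Y)" "\<And>X Y. X \<leadsto>\<^bsub>?W\<^esub> Y = word.res X Y"
      "\<f>\<^bsub>?W\<^esub> = emb 0 \<f>"
    by (simp_all add: word.closed_alg_def)
  have v: "v n \<in> carrier ?W" for n
    by (simp add: v_def W_simps emb_gclosed split: prod.split)
  have ev_G: "?ev (G i \<phi>) = emb i (f (trans_fm \<phi>))" for i \<phi>
    by (simp add: G_def v_def)
  obtain c :: "fo_fm \<Rightarrow> 'c" where c: "\<And>\<phi> \<psi>. c \<phi> = c \<psi> \<longleftrightarrow> ?ev \<phi> = ?ev \<psi>"
    using ex_fo_fm_code[OF infc] by blast
  \<comment> \<open>Terms are evaluated in the single algebra \<open>?W\<close>, hence the one-point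
    index set.\<close>
  interpret C: term_model ?W "UNIV :: unit set" "\<lambda>_. ?ev" c
    by (rule term_model.intro[OF W], unfold_locales)
      (simp_all add: c FLe_algebra.prop_eval_closed[OF W v])
  let ?C = "term_alg c ()"
  have C: "FLe_algebra ?C"
    by (rule C.FLe_algebra_term_alg)
  interpret CC: FLe_algebra ?C
    by (rule C)
  have le: "c \<phi> \<preceq>\<^bsub>?C\<^esub> c \<psi> \<longleftrightarrow> ?ev \<phi> \<subseteq> ?ev \<psi>" for \<phi> \<psi>
    unfolding C.term_alg_le_iff by (simp add: fle_def W_simps inf.absorb_iff1)
  have closed_ev: "word.gclosed (?ev \<phi>)" for \<phi>
    using FLe_algebra.prop_eval_closed[OF W v] by (simp add: W_simps)
  obtain h :: "nat \<Rightarrow> 's" where h: "inj h"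
    using infinite_countable_subset[OF infs] by blast
  define S where "S = range h"
  define d where "d u \<phi> = c (G (inv_into UNIV h u) \<phi>)" for u \<phi>
  define I where "I n = (\<lambda>u\<in>S. d u (Pred n))" for n
  have d_h: "d (h i) \<phi> = c (G i \<phi>)" for i \<phi>
    using h by (simp add: d_def)
  \<comment> \<open>These formulas have values in \<open>fixed\<close>, so all copies of the value
    coincide and their interpretation is constant over the domain.\<close>
  have fix_eq: "emb i (f (trans_fm \<phi>)) = emb j (f (trans_fm \<phi>))"
    if "\<phi> = Zero \<or> (\<exists>\<psi>. \<phi> = Forall \<psi>) \<or> (\<exists>\<psi>. \<phi> = Exists \<psi>)" for i j \<phi>
    by (rule emb_fixed) (use that hom in \<open>auto simp: is_modal_hom_def\<close>)
  have d_image: "(\<lambda>u. d u \<phi>) ` S = range (\<lambda>i. c (G i \<phi>))" for \<phi>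
    unfolding S_def by (simp add: image_image d_h)
  \<comment> \<open>One induction yields both the existence of the required meets and joins and
    their values.\<close>
  have sem: "sem ?C S I \<phi> = Some (\<lambda>u\<in>S. d u \<phi>)" for \<phi>
  proof (induction \<phi>)
    case (Forall \<phi>)
    let ?b = "f (trans_fm \<phi>)"
    have f_box: "f (trans_fm (Forall \<phi>)) = \<box> ?b"
      using hom by (simp add: is_modal_hom_def)
    have "is_glb ?C (range (\<lambda>i. c (G i \<phi>))) (c (G 0 (Forall \<phi>)))"
      unfolding is_glb_def
    proof (intro conjI ballI impI)
      show "c (G 0 (Forall \<phi>)) \<in> carrier ?C"
        by (simp add: C.term_alg_simps)
      fix x assume "x \<in> range (\<lambda>i. c (G i \<phi>))"
      then obtain i where "x = c (G i \<phi>)"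
        by blast
      moreover have "emb 0 (\<box> ?b) \<subseteq> emb i ?b"
        using fix_eq[of "Forall \<phi>" 0 i] by (simp add: f_box emb_subset_iff box_le del: trans_fm.simps)
      ultimately show "c (G 0 (Forall \<phi>)) \<preceq>\<^bsub>?C\<^esub> x"
        by (simp add: le ev_G f_box del: trans_fm.simps)
    next
      fix l assume "l \<in> carrier ?C" and l: "\<forall>x\<in>range (\<lambda>i. c (G i \<phi>)). l \<preceq>\<^bsub>?C\<^esub> x"
      \<comment> \<open>A lower bound in the subalgebra names a closed set of the amalgam, so it can
        be compared there.\<close>
      then obtain \<chi> where \<chi>: "l = c \<chi>"
        by (auto simp: C.term_alg_simps)
      have "?ev \<chi> \<subseteq> emb i ?b" for i
        using l by (simp add: \<chi> le ev_G)
      then have "?ev \<chi> \<subseteq> emb 0 (\<box> ?b)"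
        by (intro subset_emb_box) auto
      then show "l \<preceq>\<^bsub>?C\<^esub> c (G 0 (Forall \<phi>))"
        by (simp add: \<chi> le ev_G f_box del: trans_fm.simps)
    qed
    then have "glb ?C ((\<lambda>u. d u \<phi>) ` S) = Some (c (G 0 (Forall \<phi>)))"
      unfolding d_image CC.glb_eq_Some_iff .
    moreover have "d u (Forall \<phi>) = c (G 0 (Forall \<phi>))" for u
      unfolding d_def c ev_G by (rule fix_eq) simp
    then have "(\<lambda>u\<in>S. d u (Forall \<phi>)) = (\<lambda>u\<in>S. c (G 0 (Forall \<phi>)))"
      by presburger
    ultimately show ?case
      unfolding sem.simps Forall.IH by (simp add: restrict_def)
  next
    case (Exists \<phi>)
    let ?b = "f (trans_fm \<phi>)"
    have f_dia: "f (trans_fm (Exists \<phi>)) = \<diamond> ?b"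
      using hom by (simp add: is_modal_hom_def)
    have "is_lub ?C (range (\<lambda>i. c (G i \<phi>))) (c (G 0 (Exists \<phi>)))"
      unfolding is_lub_def
    proof (intro conjI ballI impI)
      show "c (G 0 (Exists \<phi>)) \<in> carrier ?C"
        by (simp add: C.term_alg_simps)
      fix x assume "x \<in> range (\<lambda>i. c (G i \<phi>))"
      then obtain i where "x = c (G i \<phi>)"
        by blast
      moreover have "emb i ?b \<subseteq> emb 0 (\<diamond> ?b)"
        using fix_eq[of "Exists \<phi>" 0 i] by (simp add: f_dia emb_subset_iff le_dia del: trans_fm.simps)
      ultimately show "x \<preceq>\<^bsub>?C\<^esub> c (G 0 (Exists \<phi>))"
        by (simp add: le ev_G f_dia del: trans_fm.simps)
    next
      fix l assume "l \<in> carrier ?C" and l: "\<forall>x\<in>range (\<lambda>i. c (G i \<phi>)). x \<preceq>\<^bsub>?C\<^esub> l"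
      then obtain \<chi> where \<chi>: "l = c \<chi>"
        by (auto simp: C.term_alg_simps)
      have "emb i ?b \<subseteq> ?ev \<chi>" for i
        using l by (simp add: \<chi> le ev_G)
      \<comment> \<open>\<open>emb_dia_subset\<close> asks for a closed upper bound, which
        \<open>closed_ev\<close> supplies.\<close>
      then have "emb 0 (\<diamond> ?b) \<subseteq> ?ev \<chi>"
        by (intro emb_dia_subset closed_ev) auto
      then show "c (G 0 (Exists \<phi>)) \<preceq>\<^bsub>?C\<^esub> l"
        by (simp add: \<chi> le ev_G f_dia del: trans_fm.simps)
    qed
    then have "lub ?C ((\<lambda>u. d u \<phi>) ` S) = Some (c (G 0 (Exists \<phi>)))"
      unfolding d_image CC.lub_eq_Some_iff .
    moreover have "d u (Exists \<phi>) = c (G 0 (Exists \<phi>))" for u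
      unfolding d_def c ev_G by (rule fix_eq) simp
    then have "(\<lambda>u\<in>S. d u (Exists \<phi>)) = (\<lambda>u\<in>S. c (G 0 (Exists \<phi>)))"
      by presburger
    ultimately show ?case
      unfolding sem.simps Exists.IH by (simp add: restrict_def)
  next
    case Zero
    \<comment> \<open>The constant of \<open>?W\<close> was taken from copy 0; since
      \<open>\<f>\<close> is fixed, it serves every copy.\<close>
    have "\<f>\<^bsub>?C\<^esub> = d u Zero" for u
      using hom fix_eq[of Zero]
      by (simp add: d_def C.term_alg_simps c ev_G W_simps is_modal_hom_def)
    then show ?case
      by (simp add: restrict_def)
  next
    case One
    have "\<one>\<^bsub>?C\<^esub> = d u One" for u
      using hom by (simp add: d_def C.term_alg_simps c ev_G W_simps is_modal_hom_def emb_one)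
    then show ?case
      by (simp add: restrict_def)
  next
    case (Meet \<phi> \<psi>)
    have "d u \<phi> \<curlywedge>\<^bsub>?C\<^esub> d u \<psi> = d u (Meet \<phi> \<psi>)" for u
      using hom by (simp add: d_def C.term_alg_simps c ev_G W_simps is_modal_hom_def emb_meet)
    with Meet show ?case
      by (auto simp: lift2_def restrict_def)
  next
    case (Join \<phi> \<psi>)
    have "d u \<phi> \<curlyvee>\<^bsub>?C\<^esub> d u \<psi> = d u (Join \<phi> \<psi>)" for u
      using hom by (simp add: d_def C.term_alg_simps c ev_G W_simps is_modal_hom_def emb_join)
    with Join show ?case
      by (auto simp: lift2_def restrict_def)
  next
    case (Mult \<phi> \<psi>)
    have "d u \<phi> \<otimes>\<^bsub>?C\<^esub> d u \<psi> = d u (Mult \<phi> \<psi>)" for u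
      using hom by (simp add: d_def C.term_alg_simps c ev_G W_simps is_modal_hom_def emb_mult)
    with Mult show ?case
      by (auto simp: lift2_def restrict_def)
  next
    case (Imp \<phi> \<psi>)
    have "d u \<phi> \<leadsto>\<^bsub>?C\<^esub> d u \<psi> = d u (Imp \<phi> \<psi>)" for u
      using hom by (simp add: d_def C.term_alg_simps c ev_G W_simps is_modal_hom_def emb_imp)
    with Imp show ?case
      by (auto simp: lift2_def restrict_def)
  qed (simp add: I_def)
  show thesis
  proof
    show "FLe_algebra ?C"
      by (rule C)
    show "is_structure ?C S I"
      unfolding is_structure_def sem by (auto simp: S_def I_def d_def C.term_alg_simps)
    show "sem ?C S I \<phi> = sem ?C S I \<psi> \<longleftrightarrow> f (trans_fm \<phi>) = f (trans_fm \<psi>)" for \<phi> \<psi>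
    proof
      assume "sem ?C S I \<phi> = sem ?C S I \<psi>"
      \<comment> \<open>One point suffices, as \<open>emb 0\<close> is injective.\<close>
      then have "(\<lambda>u\<in>S. d u \<phi>) (h 0) = (\<lambda>u\<in>S. d u \<psi>) (h 0)"
        by (simp add: sem)
      then have "emb 0 (f (trans_fm \<phi>)) = emb 0 (f (trans_fm \<psi>))"
        by (simp add: S_def d_h c ev_G)
      then show "f (trans_fm \<phi>) = f (trans_fm \<psi>)"
        by (rule emb_inj) simp_all
    next
      assume "f (trans_fm \<phi>) = f (trans_fm \<psi>)"
      then have "d u \<phi> = d u \<psi>" for u
        by (simp add: d_def c ev_G)
      then show "sem ?C S I \<phi> = sem ?C S I \<psi>"
        by (simp add: sem)
    qed
  qed
qed

text \<open>The separating structure identifies formulas exactly as \<open>f\<close> identifies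
  their translations, so \<open>T\<close> transfers to it and the conclusion transfers back.\<close>

lemma mFLe_consequence_if_FLe_consequence:
  assumes infa: "infinite (UNIV :: 'a set)" and infs: "infinite (UNIV :: 's set)"
    and cons: "FLe_consequence TYPE('a) TYPE('s) T (\<phi>, \<psi>)"
  shows "mFLe_consequence TYPE('b) (trans_eq ` T) (trans_eq (\<phi>, \<psi>))"
  unfolding mFLe_consequence_def
proof (intro allI impI)
  fix B :: "'b mFLe_alg" and f
  assume B: "mFLe_algebra B" and hom: "is_modal_hom B f"
    and T: "\<forall>(\<alpha>', \<beta>') \<in> trans_eq ` T. f \<alpha>' = f \<beta>'"
  obtain C :: "'a FLe_alg" and S :: "'s set" and I where C: "FLe_algebra C" "is_structure C S I"
    and sem: "\<And>\<phi> \<psi>. sem C S I \<phi> = sem C S I \<psi> \<longleftrightarrow> f (trans_fm \<phi>) = f (trans_fm \<psi>)"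
    using mFLe_algebra.ex_separating_structure[OF B infa infs hom] by blast
  have "\<forall>(\<phi>', \<psi>') \<in> T. sem C S I \<phi>' = sem C S I \<psi>'"
    using T by (force simp: sem trans_eq_Pair)
  then have "sem C S I \<phi> = sem C S I \<psi>"
    using cons C unfolding FLe_consequence_def by fastforce
  then show "f (fst (trans_eq (\<phi>, \<psi>))) = f (snd (trans_eq (\<phi>, \<psi>)))"
    by (simp add: sem trans_eq_Pair)
qed

theorem theorem5p3:
  fixes T :: "fo_eq set" and \<phi> \<psi> :: fo_fm
  assumes "infinite (UNIV :: 'a set)"
    and "infinite (UNIV :: 's set)"
    and "infinite (UNIV :: 'b set)"
  shows "FLe_consequence TYPE('a) TYPE('s) T (\<phi>, \<psi>) \<longleftrightarrow>
         mFLe_consequence TYPE('b) (trans_eq ` T) (trans_eq (\<phi>, \<psi>))"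
  using FLe_consequence_if_mFLe_consequence mFLe_consequence_if_FLe_consequence assms by blast

end
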